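(* Let $n\in\mathbb{N}$ and let $d$ be an integer satisfying $0\le d\le n-1$. Then for any $\mathbf{x}\in\mathbb{R}^n$ there exists a constant $c=c(n,d,\mathbf{x})>0$ such that for any $N\in\mathbb{N}$ there exists a $d$-dimensional rational affine subspace $L\subset\mathbb{R}^n$ such that $$d(\mathbf{x},L)\le c\,H(L)^{-1}N^{-\omega_d}\qquad\text{and}\qquad H(L)\le N.$$
   Context: $\omega_d:=\frac{d+1}{n-d}$. For a $d$-dimensional affine subspace $L\subset\mathbb{R}^n$, let $V_L$ be the unique $(d+1)$-dimensional linear subspace of $\mathbb{R}^{n+1}$ containing $\{(y_1,\dots,y_n,1):\mathbf{y}\in L\}$. $L$ is rational if $V_L$ has a basis consisting of vectors in $\mathbb{Z}^{n+1}$, and its height $H(L)$ is the covolume (volume of a fundamental domain) of the lattice $V_L\cap\mathbb{Z}^{n+1}$ in $V_L$. The distance is $d(\mathbf{x},L):=\min_{\mathbf{y}\in L}\max_{1\le i\le n}|x_i-y_i|$. *)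

theory Defs
  imports "HOL-Analysis.Analysis"
begin

definition omega :: "nat \<Rightarrow> nat \<Rightarrow> real" where
  "omega n d = (real d + 1) / (real n - real d)"

(* Here and below \<real>^(n+1) is the Euclidean space \<real>^n \<times> \<real>, whose inner product is the
   standard one. *)
definition lifted :: "(real ^ 'n) set \<Rightarrow> ((real ^ 'n) \<times> real) set" where
  "lifted L = (\<lambda>y. (y, 1)) ` L"

definition homogenization :: "(real ^ 'n) set \<Rightarrow> ((real ^ 'n) \<times> real) set" where
  "homogenization L =
     (THE V. subspace V \<and> int (dim V) = aff_dim L + 1 \<and> lifted L \<subseteq> V)"

definition integer_vectors :: "((real ^ 'n) \<times> real) set" where
  "integer_vectors = {v. (\<forall>i. fst v $ i \<in> \<int>) \<and> snd v \<in> \<int>}"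

definition rational_affine :: "(real ^ 'n) set \<Rightarrow> bool" where
  "rational_affine L \<longleftrightarrow>
     (\<exists>B \<subseteq> integer_vectors. independent B \<and> span B = homogenization L)"

definition orthonormal_basis :: "'a::euclidean_space set \<Rightarrow> 'a set \<Rightarrow> bool" where
  "orthonormal_basis V E \<longleftrightarrow>
     pairwise orthogonal E \<and> (\<forall>e\<in>E. norm e = 1) \<and> span E = V"

(* Lebesgue measure of dimension dim V on a linear subspace V, as a Borel measure on the
   ambient space. This is the library's construction of lborel with Basis replaced by an
   orthonormal basis of V; rotation invariance makes the choice of that basis irrelevant. *)
definition subspace_lborel :: "'a::euclidean_space set \<Rightarrow> 'a measure" where
  "subspace_lborel V =
     (let E = (SOME E. orthonormal_basis V E)
      in distr (Pi\<^sub>M E (\<lambda>_. lborel :: real measure)) borel (\<lambda>f. \<Sum>e\<in>E. f e *\<^sub>R e))"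

definition fundamental_domain ::
    "'a::euclidean_space set \<Rightarrow> 'a set \<Rightarrow> 'a set \<Rightarrow> bool" where
  "fundamental_domain V \<Lambda> F \<longleftrightarrow>
     F \<in> sets borel \<and> F \<subseteq> V \<and> (\<forall>v\<in>V. \<exists>!l. l \<in> \<Lambda> \<and> v - l \<in> F)"

(* Meaningful for a lattice \<Lambda> of full rank in V, where all fundamental domains
   have the same finite volume. *)
definition covolume :: "'a::euclidean_space set \<Rightarrow> 'a set \<Rightarrow> real" where
  "covolume V \<Lambda> = measure (subspace_lborel V) (SOME F. fundamental_domain V \<Lambda> F)"

definition height :: "(real ^ 'n) set \<Rightarrow> real" where
  "height L = covolume (homogenization L) (homogenization L \<inter> integer_vectors)"

(* The infimum is attained for nonempty affine L, since such L is closed. *)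
definition dist_sup :: "real ^ 'n \<Rightarrow> (real ^ 'n) set \<Rightarrow> real" where
  "dist_sup x L = (INF y\<in>L. infnorm (x - y))"

lemma dim_span_lifted:
  fixes L :: "(real ^ 'n) set"
  assumes "affine L" "L \<noteq> {}"
  shows "int (dim (span (lifted L))) = aff_dim L + 1"
proof -
  obtain a where a: "a \<in> L" using assms by blast
  define U where "U = (+) (- a) ` L"
  have adU: "aff_dim L = int (dim U)"
    unfolding U_def by (rule aff_dim_eq_dim) (simp add: a hull_inc)
  have lin: "linear (\<lambda>u::real^'n. (u, 0::real))"
    by (rule linearI) auto
  have inj: "inj_on (\<lambda>u::real^'n. (u, 0::real)) (span U)"
    by (auto simp: inj_on_def)
  define W where "W = (\<lambda>u::real^'n. (u, 0::real)) ` U"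
  have dW: "dim W = dim U"
    unfolding W_def by (rule dim_image_eq[OF lin inj])
  have "span W \<subseteq> {v. snd v = 0}"
    by (rule span_minimal) (auto simp: W_def subspace_def)
  hence notin: "(a, 1) \<notin> span W" by auto
  have "span (lifted L) = span (insert (a, 1) W)"
  proof
    show "span (lifted L) \<subseteq> span (insert (a, 1) W)"
    proof (rule span_minimal)
      show "lifted L \<subseteq> span (insert (a, 1) W)"
      proof
        fix v assume "v \<in> lifted L"
        then obtain y where y: "y \<in> L" "v = (y, 1)" by (auto simp: lifted_def)
        have "(- a + y, 0) \<in> span (insert (a, 1) W)"
          by (rule span_base) (use y in \<open>auto simp: W_def U_def\<close>)
        moreover have "(a, 1) \<in> span (insert (a, 1) W)"
          by (rule span_base) simp
        ultimately have "(- a + y, 0) + (a, 1) \<in> span (insert (a, 1) W)"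
          by (rule span_add)
        thus "v \<in> span (insert (a, 1) W)" by (simp add: y)
      qed
    qed simp
    show "span (insert (a, 1) W) \<subseteq> span (lifted L)"
    proof (rule span_minimal)
      have a1: "(a, 1) \<in> span (lifted L)"
        by (rule span_base) (simp add: lifted_def a)
      have "(- a + y, 0) \<in> span (lifted L)" if "y \<in> L" for y
      proof -
        have "(y, 1) \<in> span (lifted L)"
          by (rule span_base) (simp add: lifted_def that)
        from span_diff[OF this a1] show ?thesis by simp
      qed
      with a1 show "insert (a, 1) W \<subseteq> span (lifted L)"
        by (auto simp: W_def U_def)
    qed simp
  qed
  hence "dim (span (lifted L)) = dim U + 1"
    using notin dW by (simp add: dim_insert)
  thus ?thesis using adU by simp
qed

lemma homogenization_eq_span:
  fixes L :: "(real ^ 'n) set"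
  assumes "affine L" "L \<noteq> {}"
  shows "homogenization L = span (lifted L)"
  unfolding homogenization_def
proof (rule the_equality)
  show "subspace (span (lifted L)) \<and>
        int (dim (span (lifted L))) = aff_dim L + 1 \<and> lifted L \<subseteq> span (lifted L)"
    using dim_span_lifted[OF assms] span_superset by auto
next
  fix V :: "((real ^ 'n) \<times> real) set"
  assume V: "subspace V \<and> int (dim V) = aff_dim L + 1 \<and> lifted L \<subseteq> V"
  hence "span (lifted L) \<subseteq> V" by (simp add: span_minimal)
  moreover have "dim V \<le> dim (span (lifted L))"
    using V dim_span_lifted[OF assms] by linarith
  ultimately show "V = span (lifted L)"
    using subspace_dim_equal[of "span (lifted L)" V] V by auto
qed

end

theory Submission imports Defs begin

text \<open>
  Write \<open>n\<close> for the dimension and \<open>k = d + 1\<close>. A rational \<open>L\<close> of dimension \<open>d\<close> is the same as a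
  \<open>k\<close>-dimensional subspace \<open>V\<close> that is spanned by integer vectors and not contained in the hyperplane of
  vectors with last coordinate \<open>0\<close> (lemma \<open>dehomogenize\<close>). For \<open>T > 0\<close> let \<open>G(y, t) = (T (y - t x), t / T^n)\<close>;
  this map has determinant \<open>1\<close>, so it sends the integer lattice to a lattice of covolume \<open>1\<close>. Minkowski's second
  theorem gives independent integer vectors \<open>v 0, ..., v n\<close> for which the product of the lengths
  \<open>\<mu> j = norm (G (v j))\<close> is bounded, and since these lengths increase, so is the product of the first \<open>k\<close>
  of them. Let \<open>V\<close> be the span of the first \<open>k\<close> vectors.

  The last coordinate is contracted by \<open>T^n\<close> and the other directions are expanded by \<open>T\<close>. Among the
  Pluecker coordinates of \<open>V\<close>, those that involve the direction \<open>(x, 1)\<close> are therefore at most of order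
  \<open>T^(n - d)\<close>, and those that do not are at most of order \<open>T^(- k)\<close>. The former control the height of \<open>V\<close>;
  the latter control its height times the distance to \<open>x\<close>. Taking \<open>T^(n - d)\<close> proportional to \<open>N\<close> gives both
  claims. Concretely (lemma \<open>rational_subspace_from_reduced_vectors\<close>), one eliminates the last coordinate
  from all but one of the \<open>v j\<close>, choosing the pivot so that the eliminated vectors stay short, and bounds the
  volume of the resulting parallelepiped by the product of its edge lengths. For bounded \<open>N\<close> this says nothing, and
  a coordinate subspace, whose height is at most \<open>1\<close>, is used instead.

  Minkowski's theorem is obtained by counting lattice points: in an orthonormal basis adapted to the
  flag of the \<open>v j\<close>, boxes with sides proportional to the \<open>\<mu> j\<close> contain at most one lattice point
  (lemma \<open>minkowski_counting\<close>), whereas many integer points with small image can be written down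
  (lemma \<open>many_lattice_points\<close>).

  The covolume in a subspace is reached through a comparison of packings and coverings
  (lemma \<open>packing_le_covering\<close>): no fundamental domain is larger than a set whose lattice translates cover \<open>V\<close>.
  So only upper bounds for volumes of parallelepipeds are needed. These follow by packing translates
  of the parallelepiped into cubes; the comparison of two orthonormal bases is sharpened to the exact bound \<open>1\<close>
  by observing that a ratio above \<open>1\<close> would force exponential growth of the number of integer points in balls
  (lemma \<open>orthonormal_cell_volume_le_1\<close>).
\<close>

section \<open>Lebesgue measure on a subspace\<close>

text \<open>The properties of an orthonormal basis through which the measure on the subspace is accessed: coordinates
  with respect to it are inner products.\<close>

lemma orthonormal_basis_facts:
  fixes V :: "'a::euclidean_space set"
  assumes "orthonormal_basis V E"
  shows "finite E" "subspace V" "card E = dim V"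
    and "\<And>c e. e \<in> E \<Longrightarrow> (\<Sum>u\<in>E. c u *\<^sub>R u) \<bullet> e = c e"
    and "\<And>v. v \<in> V \<Longrightarrow> (\<Sum>e\<in>E. (v \<bullet> e) *\<^sub>R e) = v"
proof -
  have o: "pairwise orthogonal E" and n: "\<And>e. e \<in> E \<Longrightarrow> norm e = 1" and s: "span E = V"
    using assms by (auto simp: orthonormal_basis_def)
  have z: "0 \<notin> E" using n by force
  have i: "independent E" by (rule pairwise_orthogonal_independent[OF o z])
  show fin: "finite E" using i by (rule independent_imp_finite)
  show "subspace V" using s subspace_span by blast
  show "card E = dim V" using i s by (metis dim_eq_card dim_span)
  show coord: "(\<Sum>u\<in>E. c u *\<^sub>R u) \<bullet> e = c e" if "e \<in> E" for c e
  proof -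
    have "(\<Sum>u\<in>E. c u *\<^sub>R u) \<bullet> e = (\<Sum>u\<in>E. if u = e then c e else 0)"
      unfolding inner_sum_left
    proof (rule sum.cong)
      fix u assume "u \<in> E"
      show "c u *\<^sub>R u \<bullet> e = (if u = e then c e else 0)"
        using o n[OF that] \<open>u \<in> E\<close> that
        by (auto simp: pairwise_def orthogonal_def norm_eq_1)
    qed simp
    also have "\<dots> = c e" using fin that by simp
    finally show ?thesis .
  qed
  fix v assume "v \<in> V"
  then obtain c where c: "v = (\<Sum>u\<in>E. c u *\<^sub>R u)"
    using s span_finite[OF fin] by auto
  show "(\<Sum>e\<in>E. (v \<bullet> e) *\<^sub>R e) = v"
    by (subst (2) c, rule sum.cong) (auto simp: c coord)
qed

text \<open>The measure is defined by an unspecified orthonormal basis; this makes that basis available.\<close>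

lemma subspace_lborel_basis:
  fixes V :: "'a::euclidean_space set"
  assumes "subspace V"
  obtains E where "orthonormal_basis V E"
    "subspace_lborel V = distr (Pi\<^sub>M E (\<lambda>_. lborel :: real measure)) borel (\<lambda>f. \<Sum>e\<in>E. f e *\<^sub>R e)"
proof -
  obtain B where "B \<subseteq> V" "pairwise orthogonal B" "\<And>x. x \<in> B \<Longrightarrow> norm x = 1" "span B = V"
    using orthonormal_basis_subspace[OF assms] by metis
  hence "orthonormal_basis V B" by (simp add: orthonormal_basis_def)
  hence "orthonormal_basis V (SOME E. orthonormal_basis V E)" by (rule someI)
  thus ?thesis by (rule that) (simp add: subspace_lborel_def Let_def)
qed

lemma sets_subspace_lborel [simp]: "sets (subspace_lborel V) = sets borel"
  and space_subspace_lborel [simp]: "space (subspace_lborel V) = UNIV"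
  by (simp_all add: subspace_lborel_def Let_def)

lemma PiM_lborel_translation:
  fixes c :: "'i \<Rightarrow> real"
  assumes "finite E"
  shows "distr (Pi\<^sub>M E (\<lambda>_. lborel)) (Pi\<^sub>M E (\<lambda>_. lborel)) (\<lambda>f. \<lambda>e\<in>E. c e + f e) = Pi\<^sub>M E (\<lambda>_. lborel)"
proof -
  interpret product_sigma_finite "\<lambda>_::'i. lborel :: real measure"
    by unfold_locales
  have meas: "(\<lambda>f. \<lambda>e\<in>E. c e + f e) \<in> measurable (Pi\<^sub>M E (\<lambda>_. lborel)) (Pi\<^sub>M E (\<lambda>_. lborel))"
    by measurable
  show ?thesis
  proof (rule PiM_eqI[OF assms])
    fix A :: "'i \<Rightarrow> real set" assume A: "\<And>i. i \<in> E \<Longrightarrow> A i \<in> sets lborel"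
    have S: "Pi\<^sub>E E A \<in> sets (Pi\<^sub>M E (\<lambda>_. lborel))"
      using A assms by (intro sets_PiM_I_finite) auto
    have eq: "(\<lambda>f. \<lambda>e\<in>E. c e + f e) -` Pi\<^sub>E E A \<inter> space (Pi\<^sub>M E (\<lambda>_. lborel))
        = Pi\<^sub>E E (\<lambda>e. (\<lambda>t. c e + t) -` A e)"
      by (auto simp: space_PiM PiE_def Pi_def)
    have "emeasure lborel ((\<lambda>t. c e + t) -` A e) = emeasure lborel (A e)" if "e \<in> E" for e
    proof -
      have "emeasure lborel (A e) = emeasure (distr lborel borel ((+) (c e))) (A e)"
        by (simp add: lborel_distr_plus)
      also have "\<dots> = emeasure lborel ((\<lambda>t. c e + t) -` A e)"
        using A[OF that] by (subst emeasure_distr) auto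
      finally show ?thesis by simp
    qed
    moreover have "(\<lambda>t. c e + t) -` A e \<in> sets lborel" if "e \<in> E" for e
      using A[OF that] by (auto intro!: measurable_sets_borel)
    ultimately show "emeasure (distr (Pi\<^sub>M E (\<lambda>_. lborel)) (Pi\<^sub>M E (\<lambda>_. lborel)) (\<lambda>f. \<lambda>e\<in>E. c e + f e)) (Pi\<^sub>E E A)
       = (\<Prod>i\<in>E. emeasure lborel (A i))"
      using assms by (subst emeasure_distr[OF meas S], subst eq, subst emeasure_PiM) auto
  qed simp
qed

lemma subspace_lborel_translation:
  fixes V :: "'a::euclidean_space set"
  assumes V: "subspace V" and "v \<in> V" and A: "A \<in> sets borel"
  shows "emeasure (subspace_lborel V) {u. v + u \<in> A} = emeasure (subspace_lborel V) A"
proof -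
  obtain E where E: "orthonormal_basis V E"
    and eq: "subspace_lborel V = distr (Pi\<^sub>M E (\<lambda>_. lborel :: real measure)) borel (\<lambda>f. \<Sum>e\<in>E. f e *\<^sub>R e)"
    using subspace_lborel_basis[OF V] .
  note F = orthonormal_basis_facts[OF E]
  let ?M = "Pi\<^sub>M E (\<lambda>_. lborel :: real measure)"
  let ?p = "\<lambda>f. \<Sum>e\<in>E. f e *\<^sub>R e"
  let ?t = "\<lambda>f. \<lambda>e\<in>E. v \<bullet> e + f e"
  have m: "?p \<in> measurable ?M borel" by measurable
  have mt: "?t \<in> measurable ?M ?M" by measurable
  have pt: "?p (?t f) = v + ?p f" for f
    using F(5)[OF \<open>v \<in> V\<close>] by (simp add: scaleR_left_distrib sum.distrib)
  have B: "{u. v + u \<in> A} \<in> sets borel" using A by measurable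
  have "emeasure (subspace_lborel V) A = emeasure (distr (distr ?M ?M ?t) borel ?p) A"
    unfolding eq by (simp add: PiM_lborel_translation[OF F(1)])
  also have "distr (distr ?M ?M ?t) borel ?p = distr ?M borel (\<lambda>f. v + ?p f)"
    unfolding distr_distr[OF m mt] by (simp only: comp_def pt)
  also have "emeasure \<dots> A = emeasure ?M ((\<lambda>f. v + ?p f) -` A \<inter> space ?M)"
    using A m by (subst emeasure_distr) auto
  also have "\<dots> = emeasure (subspace_lborel V) {u. v + u \<in> A}"
    unfolding eq using B m by (subst emeasure_distr) (auto simp: vimage_def)
  finally show ?thesis by simp
qed

lemma subspace_lborel_cube:
  fixes V :: "'a::euclidean_space set"
  assumes E: "orthonormal_basis V E"
    and eq: "subspace_lborel V = distr (Pi\<^sub>M E (\<lambda>_. lborel :: real measure)) borel (\<lambda>f. \<Sum>e\<in>E. f e *\<^sub>R e)"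
    and "a \<le> b"
  shows "emeasure (subspace_lborel V) {v\<in>V. \<forall>e\<in>E. v \<bullet> e \<in> {a..b}} = ennreal ((b - a) ^ dim V)"
    and "emeasure (subspace_lborel V) {v\<in>V. \<forall>e\<in>E. v \<bullet> e \<in> {a..<b}} = ennreal ((b - a) ^ dim V)"
proof -
  note F = orthonormal_basis_facts[OF E]
  interpret product_sigma_finite "\<lambda>_::'a. lborel :: real measure"
    by unfold_locales
  let ?M = "Pi\<^sub>M E (\<lambda>_. lborel :: real measure)"
  have V: "V \<in> sets borel" using closed_subspace[OF F(2)] by (rule borel_closed)
  have *: "emeasure (subspace_lborel V) {v\<in>V. \<forall>e\<in>E. v \<bullet> e \<in> I} = ennreal ((b - a) ^ dim V)"
    if I: "I \<in> sets borel" "emeasure lborel I = ennreal (b - a)" for I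
  proof -
    have "{v\<in>V. \<forall>e\<in>E. v \<bullet> e \<in> I} = V \<inter> (\<Inter>e\<in>E. {v. v \<bullet> e \<in> I} \<inter> space borel)"
      by auto
    also have "\<dots> \<in> sets borel"
      using V F(1) I by (cases "E = {}") (auto intro!: borel_measurable_inner measurable_sets_borel simp: vimage_def[symmetric])
    finally have S: "{v\<in>V. \<forall>e\<in>E. v \<bullet> e \<in> I} \<in> sets borel" .
    have inV: "(\<Sum>e\<in>E. f e *\<^sub>R e) \<in> V" for f
    proof -
      have "(\<Sum>e\<in>E. f e *\<^sub>R e) \<in> span E" by (intro span_sum span_scale span_base)
      thus ?thesis using E by (simp add: orthonormal_basis_def)
    qed
    have "(\<lambda>f. \<Sum>e\<in>E. f e *\<^sub>R e) -` {v\<in>V. \<forall>e\<in>E. v \<bullet> e \<in> I} \<inter> space ?M = Pi\<^sub>E E (\<lambda>_. I)"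
      by (auto simp: space_PiM F(4) inV)
    hence "emeasure (subspace_lborel V) {v\<in>V. \<forall>e\<in>E. v \<bullet> e \<in> I} = emeasure ?M (Pi\<^sub>E E (\<lambda>_. I))"
      unfolding eq using S by (subst emeasure_distr) auto
    also have "\<dots> = (\<Prod>e\<in>E. ennreal (b - a))"
      using I F(1) by (subst emeasure_PiM) auto
    finally show ?thesis using \<open>a \<le> b\<close> F(3) by (simp add: ennreal_power)
  qed
  show "emeasure (subspace_lborel V) {v\<in>V. \<forall>e\<in>E. v \<bullet> e \<in> {a..b}} = ennreal ((b - a) ^ dim V)"
    using \<open>a \<le> b\<close> by (intro *) auto
  show "emeasure (subspace_lborel V) {v\<in>V. \<forall>e\<in>E. v \<bullet> e \<in> {a..<b}} = ennreal ((b - a) ^ dim V)"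
    using \<open>a \<le> b\<close> by (intro *) auto
qed

section \<open>Packing and covering\<close>

text \<open>If the translates of \<open>A\<close> by \<open>\<Lambda>\<close> are disjoint and those of \<open>B\<close> cover \<open>A\<close>, cut \<open>A\<close> into pieces each of which
  lies in one translate of \<open>B\<close> and move these pieces back into \<open>B\<close>; they remain disjoint there.\<close>

lemma packing_le_covering:
  fixes A B \<Lambda> :: "'a::euclidean_space set"
  assumes V: "subspace V" and "countable \<Lambda>" "\<Lambda> \<subseteq> V"
    and A: "A \<in> sets borel" and B: "B \<in> sets borel"
    and pack: "\<And>a l l'. a \<in> V \<Longrightarrow> l \<in> \<Lambda> \<Longrightarrow> l' \<in> \<Lambda> \<Longrightarrow> a - l \<in> A \<Longrightarrow> a - l' \<in> A \<Longrightarrow> l = l'"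
    and BV: "B \<subseteq> V"
    and neg: "\<And>l. l \<in> \<Lambda> \<Longrightarrow> - l \<in> \<Lambda>"
    and cover: "\<And>a. a \<in> A \<Longrightarrow> \<exists>l\<in>\<Lambda>. a - l \<in> B"
  shows "emeasure (subspace_lborel V) A \<le> emeasure (subspace_lborel V) B"
proof -
  let ?\<mu> = "subspace_lborel V"
  have m: "{b. b + l \<in> S} \<in> sets borel" "{b. l + b \<in> S} \<in> sets borel" if "S \<in> sets borel" for S :: "'a set" and l
    using that by measurable
  have mB: "A \<inter> {a. a - l \<in> B} \<in> sets borel" for l using A B by measurable
  have eq: "emeasure ?\<mu> (A \<inter> {a. a - l \<in> B}) = emeasure ?\<mu> (B \<inter> {b. l + b \<in> A})" if "l \<in> \<Lambda>" for l
  proof -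
    have "{u. l + u \<in> A \<inter> {a. a - l \<in> B}} = B \<inter> {b. l + b \<in> A}" by auto
    thus ?thesis using subspace_lborel_translation[OF V _ mB, of l l] that assms(3) by auto
  qed
  \<comment> \<open>Index the pieces by natural numbers; \<open>D i\<close> has at most one element.\<close>
  define D where "D i = {l\<in>\<Lambda>. to_nat_on \<Lambda> l = i}" for i
  have D: "D i = {} \<or> (\<exists>l\<in>\<Lambda>. D i = {l})" for i
    using \<open>countable \<Lambda>\<close> by (force simp: D_def)
  define X where "X i = (\<Union>l\<in>D i. A \<inter> {a. a - l \<in> B})" for i
  define Y where "Y i = (\<Union>l\<in>D i. B \<inter> {b. l + b \<in> A})" for i
  have X: "X i \<in> sets ?\<mu>" and Y: "Y i \<in> sets ?\<mu>" and XY: "emeasure ?\<mu> (X i) = emeasure ?\<mu> (Y i)" for i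
    using D[of i] mB B m(2)[OF A] eq by (auto simp: X_def Y_def)
  have disj: "disjoint_family Y"
    unfolding disjoint_family_on_def
  proof (intro ballI impI)
    fix i j :: nat assume "i \<noteq> j"
    show "Y i \<inter> Y j = {}"
    proof (rule ccontr)
      assume "Y i \<inter> Y j \<noteq> {}"
      then obtain b l l' where *: "b \<in> B" "l \<in> D i" "l' \<in> D j" "l + b \<in> A" "l' + b \<in> A"
        by (auto simp: Y_def)
      have "- l = - l'"
        using * BV by (intro pack[of b] neg) (auto simp: D_def add.commute)
      thus False using * \<open>i \<noteq> j\<close> by (auto simp: D_def)
    qed
  qed
  have "A \<subseteq> (\<Union>i. X i)"
  proof
    fix a assume "a \<in> A"
    with cover obtain l where "l \<in> \<Lambda>" "a - l \<in> B" by blast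
    with \<open>a \<in> A\<close> have "a \<in> X (to_nat_on \<Lambda> l)" by (auto simp: X_def D_def)
    thus "a \<in> (\<Union>i. X i)" by blast
  qed
  hence "A = (\<Union>i. X i)" by (auto simp: X_def)
  hence "emeasure ?\<mu> A \<le> (\<Sum>i. emeasure ?\<mu> (X i))"
    using emeasure_subadditive_countably[of X ?\<mu>] X by auto
  also have "\<dots> = emeasure ?\<mu> (\<Union>i. Y i)"
    unfolding XY using Y by (intro suminf_emeasure disj) auto
  also have "\<dots> \<le> emeasure ?\<mu> B"
    using B by (intro emeasure_mono) (auto simp: Y_def)
  finally show ?thesis .
qed

section \<open>Volumes of parallelepipeds\<close>

text \<open>A basis \<open>b\<close> of \<open>V\<close> indexed by \<open>J\<close>, together with linear functionals \<open>f\<close> on the whole space that read off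
  coordinates. Having the functionals explicit makes half-open parallelepipeds visibly Borel, and the index set
  allows two bases of the same subspace to be compared coordinate by coordinate.\<close>

definition dual_family :: "'a::euclidean_space set \<Rightarrow> 'i set \<Rightarrow> ('i \<Rightarrow> 'a) \<Rightarrow> ('i \<Rightarrow> 'a \<Rightarrow> real) \<Rightarrow> bool" where
  "dual_family V J b f \<longleftrightarrow> subspace V \<and> finite J \<and> card J = dim V \<and> b ` J \<subseteq> V \<and> (\<forall>j\<in>J. linear (f j)) \<and>
     (\<forall>i\<in>J. \<forall>j\<in>J. f i (b j) = (if i = j then 1 else 0)) \<and>
     (\<forall>v\<in>V. (\<Sum>j\<in>J. f j v *\<^sub>R b j) = v)"

text \<open>The half-open parallelepiped spanned by the basis with coordinate functionals \<open>f\<close>, translated to the grid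
  point with coordinates \<open>z\<close>.\<close>

definition cell :: "'a::euclidean_space set \<Rightarrow> 'i set \<Rightarrow> ('i \<Rightarrow> 'a \<Rightarrow> real) \<Rightarrow> ('i \<Rightarrow> int) \<Rightarrow> 'a set" where
  "cell V J f z = {v\<in>V. \<forall>j\<in>J. \<lfloor>f j v\<rfloor> = z j}"

lemma dual_family_coord:
  assumes "dual_family V J b f" "i \<in> J"
  shows "f i (\<Sum>j\<in>J. c j *\<^sub>R b j) = c i"
proof -
  have l: "linear (f i)" and fin: "finite J"
    and d: "\<And>j. j \<in> J \<Longrightarrow> f i (b j) = (if i = j then 1 else 0)"
    using assms by (auto simp: dual_family_def)
  have "f i (\<Sum>j\<in>J. c j *\<^sub>R b j) = (\<Sum>j\<in>J. c j * f i (b j))"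
    using l by (simp add: linear_sum linear_scale)
  also have "\<dots> = (\<Sum>j\<in>J. if i = j then c j else 0)"
    by (intro sum.cong) (auto simp: d)
  finally show ?thesis using fin assms(2) by simp
qed

lemma cell_borel:
  fixes V :: "'a::euclidean_space set"
  assumes "dual_family V J b f"
  shows "cell V J f z \<in> sets borel"
proof -
  have lin: "linear (f j)" if "j \<in> J" for j using assms that by (auto simp: dual_family_def)
  have m: "{v. \<lfloor>f j v\<rfloor> = z j} \<in> sets borel" if "j \<in> J" for j
  proof -
    have "f j \<in> borel_measurable borel"
      using linear_continuous_on[OF linear_conv_bounded_linear[THEN iffD1, OF lin[OF that]], of UNIV]
      by (rule borel_measurable_continuous_onI)
    hence "f j -` {of_int (z j)..<of_int (z j) + 1} \<inter> space borel \<in> sets borel"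
      by (rule measurable_sets) simp
    moreover have "f j -` {of_int (z j)..<of_int (z j) + 1} = {v. \<lfloor>f j v\<rfloor> = z j}"
      by (auto simp: floor_eq_iff)
    ultimately show ?thesis by simp
  qed
  have V: "V \<in> sets borel"
    using assms closed_subspace by (auto simp: dual_family_def intro: borel_closed)
  have "cell V J f z = (if J = {} then V else V \<inter> (\<Inter>j\<in>J. {v. \<lfloor>f j v\<rfloor> = z j}))"
    by (auto simp: cell_def)
  also have "\<dots> \<in> sets borel"
    using V m assms by (auto simp: dual_family_def)
  finally show ?thesis .
qed

lemma emeasure_cell:
  fixes V :: "'a::euclidean_space set"
  assumes D: "dual_family V J b f"
  shows "emeasure (subspace_lborel V) (cell V J f z) = emeasure (subspace_lborel V) (cell V J f (\<lambda>_. 0))"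
proof -
  define w where "w = (\<Sum>j\<in>J. of_int (z j) *\<^sub>R b j)"
  have V: "subspace V" and lin: "\<And>j. j \<in> J \<Longrightarrow> linear (f j)" and b: "\<And>j. j \<in> J \<Longrightarrow> b j \<in> V"
    using D by (auto simp: dual_family_def)
  have w: "w \<in> V" unfolding w_def using V b by (auto intro!: subspace_sum subspace_scale)
  have "f j (w + u) = of_int (z j) + f j u" if "j \<in> J" for j u
    using lin[OF that] dual_family_coord[OF D that] by (simp add: linear_add w_def)
  moreover have "w + u \<in> V \<longleftrightarrow> u \<in> V" for u
    using w V subspace_add subspace_diff by (metis add_diff_cancel_left')
  ultimately have "{u. w + u \<in> cell V J f z} = cell V J f (\<lambda>_. 0)"
    by (auto simp: cell_def)
  thus ?thesis using subspace_lborel_translation[OF V w cell_borel[OF D]] by metis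
qed

lemma emeasure_Union_cells:
  fixes V :: "'a::euclidean_space set"
  assumes D: "dual_family V J b f" and Z: "finite Z" "Z \<subseteq> extensional J"
  shows "emeasure (subspace_lborel V) (\<Union>z\<in>Z. cell V J f z)
     = of_nat (card Z) * emeasure (subspace_lborel V) (cell V J f (\<lambda>_. 0))"
proof -
  have "disjoint_family_on (cell V J f) Z"
    unfolding disjoint_family_on_def
  proof (intro ballI impI)
    fix y z assume yz: "y \<in> Z" "z \<in> Z" "y \<noteq> z"
    then obtain j where "j \<in> J" "y j \<noteq> z j" using Z extensionalityI by (metis subsetD)
    thus "cell V J f y \<inter> cell V J f z = {}" by (force simp: cell_def)
  qed
  hence "emeasure (subspace_lborel V) (\<Union>z\<in>Z. cell V J f z)
     = (\<Sum>z\<in>Z. emeasure (subspace_lborel V) (cell V J f z))"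
    using Z cell_borel[OF D] by (intro sum_emeasure[symmetric]) auto
  also have "\<dots> = (\<Sum>z\<in>Z. emeasure (subspace_lborel V) (cell V J f (\<lambda>_. 0)))"
    by (intro sum.cong refl emeasure_cell[OF D])
  finally show ?thesis by simp
qed

text \<open>Grid cells are disjoint and have equal volume, so that a set containing many of them bounds the volume of one.\<close>

lemma cell_packing:
  fixes V :: "'a::euclidean_space set"
  assumes D: "dual_family V J b f" and Z: "finite Z" "Z \<subseteq> extensional J" "Z \<noteq> {}"
    and S: "S \<in> sets borel" "(\<Union>z\<in>Z. cell V J f z) \<subseteq> S"
    and s: "emeasure (subspace_lborel V) S \<le> ennreal s" "0 \<le> s"
  shows "emeasure (subspace_lborel V) (cell V J f (\<lambda>_. 0)) \<le> ennreal (s / card Z)"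
proof -
  let ?c = "emeasure (subspace_lborel V) (cell V J f (\<lambda>_. 0))"
  have c: "card Z > 0" using Z by (simp add: card_gt_0_iff)
  have "of_nat (card Z) * ?c \<le> emeasure (subspace_lborel V) S"
    unfolding emeasure_Union_cells[OF D Z(1,2), symmetric] using S by (intro emeasure_mono) auto
  hence *: "of_nat (card Z) * ?c \<le> ennreal s" using s by simp
  have "?c \<noteq> \<infinity>"
  proof
    assume "?c = \<infinity>"
    with * c show False by (simp add: ennreal_mult_top top_unique)
  qed
  then obtain r where r: "?c = ennreal r" "0 \<le> r" by (cases ?c) auto
  have "ennreal (real (card Z) * r) \<le> ennreal s"
    using * r by (simp add: ennreal_mult ennreal_of_nat_eq_real_of_nat)
  hence "real (card Z) * r \<le> s" using s by (simp add: ennreal_le_iff)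
  thus ?thesis using r c by (auto simp: field_simps intro!: ennreal_leI)
qed

text \<open>Hadamard's inequality up to a constant, with no reference to determinants. Stack about \<open>\<rho> / norm (b j)\<close>
  copies of the parallelepiped in each direction \<open>b j\<close>. For large \<open>\<rho>\<close> they lie in a ball of radius \<open>k \<rho>\<close>,
  hence in a cube whose volume is known in the basis defining the measure.\<close>

lemma parallelepiped_volume_le:
  fixes V :: "'a::euclidean_space set"
  assumes D: "dual_family V J b f"
  shows "emeasure (subspace_lborel V) (cell V J f (\<lambda>_. 0))
     \<le> ennreal ((4 * real (dim V)) ^ dim V * (\<Prod>j\<in>J. norm (b j)))"
proof -
  have V: "subspace V" and fin: "finite J" and k: "card J = dim V"
    and rep: "\<And>v. v \<in> V \<Longrightarrow> (\<Sum>j\<in>J. f j v *\<^sub>R b j) = v"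
    and lin: "\<And>j. j \<in> J \<Longrightarrow> linear (f j)"
    and one: "\<And>j. j \<in> J \<Longrightarrow> f j (b j) = 1"
    using D by (auto simp: dual_family_def)
  obtain E where E: "orthonormal_basis V E"
    and eq: "subspace_lborel V = distr (Pi\<^sub>M E (\<lambda>_. lborel :: real measure)) borel (\<lambda>f. \<Sum>e\<in>E. f e *\<^sub>R e)"
    using subspace_lborel_basis[OF V] .
  define k where "k = dim V"
  define \<rho> where "\<rho> = 1 + (\<Sum>j\<in>J. norm (b j))"
  have \<rho>0: "\<rho> > 0" unfolding \<rho>_def by (smt (verit) norm_ge_zero sum_nonneg)
  have \<rho>: "norm (b j) \<le> \<rho>" if "j \<in> J" for j
    using member_le_sum[of j J "\<lambda>j. norm (b j)"] that fin by (auto simp: \<rho>_def)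
  have b0: "norm (b j) > 0" if "j \<in> J" for j
    using one[OF that] linear_0[OF lin[OF that]] by auto
  define M where "M j = nat \<lfloor>\<rho> / norm (b j)\<rfloor>" for j
  have M1: "real (M j) \<le> \<rho> / norm (b j)" if "j \<in> J" for j
    using \<rho>0 b0[OF that] by (simp add: M_def)
  have M2: "\<rho> / (2 * norm (b j)) \<le> real (M j)" if "j \<in> J" for j
  proof -
    define q where "q = \<rho> / norm (b j)"
    have "1 \<le> q" using \<rho>[OF that] b0[OF that] by (simp add: q_def)
    hence "1 \<le> \<lfloor>q\<rfloor>" by simp
    hence "q / 2 \<le> real (nat \<lfloor>q\<rfloor>)" by linarith
    thus ?thesis by (simp add: M_def q_def)
  qed
  have M0: "real (M j) > 0" if "j \<in> J" for j
    using M2[OF that] \<rho>0 b0[OF that] by (smt (verit) divide_pos_pos)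
  define Z where "Z = Pi\<^sub>E J (\<lambda>j. {0..<int (M j)})"
  have cardZ: "card Z = (\<Prod>j\<in>J. M j)" using fin by (simp add: Z_def card_PiE)
  define R where "R = real k * \<rho>"
  let ?S = "{v\<in>V. \<forall>e\<in>E. v \<bullet> e \<in> {-R..R}}"
  have R0: "R \<ge> 0" using \<rho>0 by (simp add: R_def)
  have Sb: "?S \<in> sets borel"
  proof -
    have "?S = V \<inter> (\<Inter>e\<in>E. {v. v \<bullet> e \<ge> -R} \<inter> {v. v \<bullet> e \<le> R})" by auto
    moreover have "closed {v. v \<bullet> e \<ge> -R}" "closed {v. v \<bullet> e \<le> R}" for e :: 'a
      by (intro closed_Collect_le continuous_intros)+
    ultimately have "closed ?S" using closed_subspace[OF V] by (auto intro!: closed_Int)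
    thus ?thesis by (rule borel_closed)
  qed
  have US: "(\<Union>z\<in>Z. cell V J f z) \<subseteq> ?S"
  proof
    fix v assume "v \<in> (\<Union>z\<in>Z. cell V J f z)"
    then obtain z where z: "z \<in> Z" "v \<in> V" "\<And>j. j \<in> J \<Longrightarrow> \<lfloor>f j v\<rfloor> = z j"
      by (auto simp: cell_def)
    have "norm (f j v *\<^sub>R b j) \<le> \<rho>" if "j \<in> J" for j
    proof -
      have "z j \<in> {0..<int (M j)}" using z(1) that by (auto simp: Z_def)
      hence "0 \<le> f j v" "f j v \<le> M j" using z(3)[OF that] by auto linarith+
      hence "\<bar>f j v\<bar> \<le> \<rho> / norm (b j)" using M1[OF that] by linarith
      thus ?thesis using b0[OF that] by (simp add: field_simps)
    qed
    hence "norm (\<Sum>j\<in>J. f j v *\<^sub>R b j) \<le> (\<Sum>j\<in>J. \<rho>)" by (intro sum_norm_le) auto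
    hence nv: "norm v \<le> R" using rep[OF z(2)] k by (simp add: R_def k_def)
    have "\<bar>v \<bullet> e\<bar> \<le> R" if "e \<in> E" for e
    proof -
      have "norm e = 1" using E that by (auto simp: orthonormal_basis_def)
      thus ?thesis using Cauchy_Schwarz_ineq2[of v e] nv by simp
    qed
    thus "v \<in> ?S" using z(2) by (auto simp: abs_le_iff minus_le_iff)
  qed
  have "emeasure (subspace_lborel V) (cell V J f (\<lambda>_. 0)) \<le> ennreal ((R - (-R)) ^ dim V / card Z)"
  proof (rule cell_packing[OF D _ _ _ Sb US])
    show "Z \<noteq> {}" using M0 by (auto simp: Z_def PiE_eq_empty_iff)
    show "finite Z" using fin by (auto simp: Z_def intro!: finite_PiE)
    show "Z \<subseteq> extensional J" by (auto simp: Z_def PiE_def)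
    have "-R \<le> R" using R0 by simp
    from subspace_lborel_cube(1)[OF E eq this]
    show "emeasure (subspace_lborel V) ?S \<le> ennreal ((R - (-R)) ^ dim V)"
      by (rule eq_refl)
    show "0 \<le> (R - (-R)) ^ dim V" using R0 by (intro zero_le_power) linarith
  qed
  also have "\<dots> \<le> ennreal ((4 * real (dim V)) ^ dim V * (\<Prod>j\<in>J. norm (b j)))"
  proof (rule ennreal_leI)
    have "\<rho> ^ k / (2 ^ k * (\<Prod>j\<in>J. norm (b j))) = (\<Prod>j\<in>J. \<rho> / (2 * norm (b j)))"
      using k by (simp add: prod_dividef prod.distrib k_def)
    also have "\<dots> \<le> (\<Prod>j\<in>J. real (M j))" using M2 \<rho>0 by (intro prod_mono) auto
    finally have *: "\<rho> ^ k / (2 ^ k * (\<Prod>j\<in>J. norm (b j))) \<le> card Z" by (simp add: cardZ)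
    have p: "(\<Prod>j\<in>J. norm (b j)) > 0" using b0 by (intro prod_pos) auto
    have "R - (-R) = 2 * real k * \<rho>" by (simp add: R_def)
    hence "(R - (-R)) ^ k = (2 * real k) ^ k * \<rho> ^ k" by (simp only: power_mult_distrib)
    also have "\<dots> \<le> (2 * real k) ^ k * (card Z * (2 ^ k * (\<Prod>j\<in>J. norm (b j))))"
      using * p by (intro mult_left_mono) (auto simp: field_simps)
    also have "\<dots> = (2 * real k * 2) ^ k * (\<Prod>j\<in>J. norm (b j)) * card Z"
      unfolding power_mult_distrib by (simp only: ac_simps)
    finally have "(R - (-R)) ^ k \<le> (4 * real k) ^ k * (\<Prod>j\<in>J. norm (b j)) * card Z"
      by (simp add: mult.commute)
    moreover have "card Z > 0" unfolding cardZ using M0 by (intro prod_pos) auto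
    ultimately show "(R - (-R)) ^ dim V / card Z \<le> (4 * real (dim V)) ^ dim V * (\<Prod>j\<in>J. norm (b j))"
      by (simp add: k_def divide_le_eq)
  qed
  finally show ?thesis .
qed

section \<open>Comparison of orthonormal bases\<close>

text \<open>The norm depends only on the coefficients. Hence balls contain the same number of grid points for any two
  orthonormal bases of a subspace.\<close>

lemma norm_orthonormal_sum:
  fixes h :: "'i \<Rightarrow> 'a::euclidean_space"
  assumes "finite J" "\<And>i j. i \<in> J \<Longrightarrow> j \<in> J \<Longrightarrow> h i \<bullet> h j = (if i = j then 1 else 0)"
  shows "norm (\<Sum>j\<in>J. c j *\<^sub>R h j) = L2_set c J"
proof -
  have "(\<Sum>j\<in>J. c j *\<^sub>R h j) \<bullet> (\<Sum>j\<in>J. c j *\<^sub>R h j) = (\<Sum>i\<in>J. \<Sum>j\<in>J. c i * (c j * (h i \<bullet> h j)))"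
    unfolding inner_sum_left by (simp add: inner_sum_right sum_distrib_left mult.left_commute)
  also have "\<dots> = (\<Sum>i\<in>J. \<Sum>j\<in>J. if i = j then (c j)\<^sup>2 else 0)"
    by (intro sum.cong) (auto simp: assms power2_eq_square)
  also have "\<dots> = (\<Sum>i\<in>J. (c i)\<^sup>2)" using assms(1) by simp
  finally show ?thesis by (simp add: norm_eq_sqrt_inner L2_set_def)
qed

text \<open>Taking \<open>k\<close>-th roots reduces this to the comparison of a geometric sequence with a linear one.\<close>

lemma geometric_le_polynomial_imp_le_1:
  fixes r :: real
  assumes "\<And>i::nat. r ^ i \<le> (C * real i + 1) ^ k"
  shows "r \<le> 1"
proof (rule ccontr)
  assume "\<not> r \<le> 1"
  hence r: "r > 1" by simp
  show False
  proof (cases "k = 0")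
    case True
    thus False using assms[of 1] r by simp
  next
    case False
    define s where "s = root k r"
    have s: "s > 1" "s ^ k = r" using r False by (auto simp: s_def)
    have "s ^ i \<le> \<bar>C\<bar> * real i + 1" for i
    proof -
      have "(s ^ i) ^ k \<le> (C * real i + 1) ^ k"
        using assms[of i] unfolding s(2)[symmetric] by (simp add: power_mult[symmetric] mult.commute)
      also have "\<dots> \<le> \<bar>C * real i + 1\<bar> ^ k" by (metis abs_ge_self power_abs)
      finally have "s ^ i \<le> \<bar>C * real i + 1\<bar>" 
        using False s(1) power_mono_iff[of "s ^ i" "\<bar>C * real i + 1\<bar>" k] by simp
      also have "\<dots> \<le> \<bar>C * real i\<bar> + 1" by linarith
      finally show ?thesis by (simp add: abs_mult)
    qed
    hence "1 \<le> \<bar>C\<bar> * (real i * (1/s) ^ i) + (1/s) ^ i" for i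
      using s(1) by (simp add: power_divide field_simps)
    moreover have "(\<lambda>i. \<bar>C\<bar> * (real i * (1/s) ^ i) + (1/s) ^ i) \<longlonglongrightarrow> \<bar>C\<bar> * 0 + 0"
      using s(1) by (intro tendsto_intros powser_times_n_limit_0 LIMSEQ_realpow_zero) auto
    ultimately have "(1::real) \<le> \<bar>C\<bar> * 0 + 0"
      by (intro LIMSEQ_le_const) auto
    thus False by simp
  qed
qed

lemma orthonormal_dual_family:
  fixes V :: "'a::euclidean_space set"
  assumes E: "orthonormal_basis V E" and h: "bij_betw h J E"
  shows "dual_family V J h (\<lambda>j v. v \<bullet> h j)"
    and "\<And>i j. i \<in> J \<Longrightarrow> j \<in> J \<Longrightarrow> h i \<bullet> h j = (if i = j then 1 else 0)"
proof -
  note F = orthonormal_basis_facts[OF E]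
  have E': "pairwise orthogonal E" "\<And>e. e \<in> E \<Longrightarrow> norm e = 1" "E \<subseteq> V"
    using E span_superset by (auto simp: orthonormal_basis_def)
  have hE: "h j \<in> E" if "j \<in> J" for j using h that by (auto simp: bij_betw_def)
  show ip: "h i \<bullet> h j = (if i = j then 1 else 0)" if "i \<in> J" "j \<in> J" for i j
  proof (cases "i = j")
    case True
    then show ?thesis using E'(2)[OF hE[OF that(1)]] by (simp add: norm_eq_1)
  next
    case False
    hence "h i \<noteq> h j" using h that by (auto simp: bij_betw_def inj_on_def)
    thus ?thesis using E'(1) hE that False by (auto simp: pairwise_def orthogonal_def)
  qed
  have "(\<Sum>j\<in>J. (v \<bullet> h j) *\<^sub>R h j) = v" if "v \<in> V" for v
    using F(5)[OF that] sum.reindex_bij_betw[OF h, of "\<lambda>e. (v \<bullet> e) *\<^sub>R e"] by simp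
  moreover have "linear (\<lambda>v. v \<bullet> h j)" for j
    by (simp add: bounded_linear.linear bounded_linear_inner_left)
  ultimately show "dual_family V J h (\<lambda>j v. v \<bullet> h j)"
    using F h hE E'(3) ip bij_betw_finite[OF h] bij_betw_same_card[OF h]
    by (auto simp: dual_family_def inner_commute)
qed

text \<open>The measure is defined by a basis \<open>E\<close> unrelated to \<open>E\<^sub>0\<close>; this is the part of rotation invariance that is needed.
  Let \<open>r\<close> be the volume of a unit cell of \<open>E\<^sub>0\<close>. Each \<open>E\<^sub>0\<close>-cell at a grid point of norm at most \<open>2kn\<close> is covered by
  \<open>E\<close>-cells at grid points of norm at most \<open>2k(n + 1)\<close>, and \<open>E\<close>-cells have volume \<open>1\<close>. With \<open>Z n\<close> the set of
  integer coefficient vectors of norm at most \<open>2kn\<close>, which serves for both bases, this gives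
  \<open>r * card (Z n) \<le> card (Z (n + 1))\<close>, so \<open>r ^ n \<le> card (Z n)\<close>. But \<open>card (Z n)\<close> grows polynomially.\<close>

lemma orthonormal_cell_volume_le_1:
  fixes V :: "'a::euclidean_space set"
  assumes V: "subspace V" and E0: "orthonormal_basis V E\<^sub>0"
  shows "emeasure (subspace_lborel V) (cell V E\<^sub>0 (\<lambda>e v. v \<bullet> e) (\<lambda>_. 0)) \<le> 1"
proof -
  obtain E where E: "orthonormal_basis V E"
    and eq: "subspace_lborel V = distr (Pi\<^sub>M E (\<lambda>_. lborel :: real measure)) borel (\<lambda>f. \<Sum>e\<in>E. f e *\<^sub>R e)"
    using subspace_lborel_basis[OF V] .
  note F = orthonormal_basis_facts[OF E] and F0 = orthonormal_basis_facts[OF E0]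
  define k where "k = dim V"
  have "bij_betw (\<lambda>e. e) E E" by (simp add: bij_betw_def)
  note D = orthonormal_dual_family[OF E this]
  obtain h where h: "bij_betw h E E\<^sub>0"
    using F(1,3) F0(1,3) by (metis bij_betw_iff_card)
  note D0 = orthonormal_dual_family[OF E0 h]
  have fin: "finite E" by (rule F(1))
  let ?\<mu> = "subspace_lborel V"
  let ?c = "cell V E (\<lambda>e v. v \<bullet> e)" and ?d = "cell V E (\<lambda>e v. v \<bullet> h e)"
  have same: "cell V E\<^sub>0 (\<lambda>e v. v \<bullet> e) (\<lambda>_. 0) = ?d (\<lambda>_. 0)"
    using h by (auto simp: cell_def bij_betw_def)
  have c1: "emeasure ?\<mu> (?c (\<lambda>_. 0)) = 1"
    using subspace_lborel_cube(2)[OF E eq, of 0 1] by (simp add: cell_def floor_eq_iff)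
  define Z where "Z n = {z \<in> extensional E. L2_set (\<lambda>e. of_int (z e)) E \<le> 2 * real k * real n}" for n :: nat
  have Zsub: "Z n \<subseteq> Pi\<^sub>E E (\<lambda>_. {- int (2*k*n) .. int (2*k*n)})" for n
  proof
    fix z assume z: "z \<in> Z n"
    have "z e \<in> {- int (2*k*n) .. int (2*k*n)}" if "e \<in> E" for e
    proof -
      have "\<bar>real_of_int (z e)\<bar> \<le> L2_set (\<lambda>e. of_int (z e)) E"
        using member_le_L2_set[OF fin that, of "\<lambda>e. \<bar>of_int (z e)\<bar>"] by (simp add: L2_set_def)
      also have "\<dots> \<le> 2 * real k * real n" using z by (simp add: Z_def)
      finally have "real_of_int \<bar>z e\<bar> \<le> real_of_int (int (2*k*n))" by simp
      hence "\<bar>z e\<bar> \<le> int (2*k*n)" by linarith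
      thus ?thesis by auto
    qed
    thus "z \<in> Pi\<^sub>E E (\<lambda>_. {- int (2*k*n) .. int (2*k*n)})" using z by (auto simp: Z_def PiE_def)
  qed
  have finP: "finite (Pi\<^sub>E E (\<lambda>_. {- int (2*k*n) .. int (2*k*n)}))" for n
    using fin by (intro finite_PiE) auto
  have finZ: "finite (Z n)" for n using Zsub finP by (rule finite_subset)
  have Zle: "real (card (Z n)) \<le> (4 * real k * real n + 1) ^ k" for n
  proof -
    have "card (Z n) \<le> card (Pi\<^sub>E E (\<lambda>_. {- int (2*k*n) .. int (2*k*n)}))"
      by (rule card_mono[OF finP Zsub])
    also have "\<dots> = card {- int (2*k*n) .. int (2*k*n)} ^ k"
      using fin F(3) by (simp only: card_PiE prod_constant k_def)
    also have "card {- int (2*k*n) .. int (2*k*n)} = 4*k*n+1"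
      unfolding card_atLeastAtMost_int by linarith
    finally have "real (card (Z n)) \<le> real ((4*k*n+1) ^ k)" by (rule of_nat_mono)
    thus ?thesis by (simp add: algebra_simps)
  qed
  have Zne: "Z n \<noteq> {}" for n
  proof -
    have "(\<lambda>e\<in>E. 0) \<in> Z n" by (auto simp: Z_def L2_set_def)
    thus ?thesis by blast
  qed
  have near: "norm (v - (\<Sum>e\<in>E. of_int \<lfloor>v \<bullet> b e\<rfloor> *\<^sub>R b e)) \<le> k"
    if "v \<in> V" and b: "dual_family V E b (\<lambda>e v. v \<bullet> b e)" and "\<And>e. e \<in> E \<Longrightarrow> norm (b e) = 1" for v b
  proof -
    have "v = (\<Sum>e\<in>E. (v \<bullet> b e) *\<^sub>R b e)" using b that(1) by (simp add: dual_family_def)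
    hence "v - (\<Sum>e\<in>E. of_int \<lfloor>v \<bullet> b e\<rfloor> *\<^sub>R b e) = (\<Sum>e\<in>E. (v \<bullet> b e - of_int \<lfloor>v \<bullet> b e\<rfloor>) *\<^sub>R b e)"
      by (simp add: scaleR_left_diff_distrib sum_subtractf)
    also have "norm \<dots> \<le> (\<Sum>e\<in>E. 1)"
    proof (rule sum_norm_le)
      fix e assume "e \<in> E"
      have "0 \<le> v \<bullet> b e - of_int \<lfloor>v \<bullet> b e\<rfloor>" "v \<bullet> b e - of_int \<lfloor>v \<bullet> b e\<rfloor> \<le> 1" by linarith+
      thus "norm ((v \<bullet> b e - of_int \<lfloor>v \<bullet> b e\<rfloor>) *\<^sub>R b e) \<le> 1"
        using that(3)[OF \<open>e \<in> E\<close>] by simp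
    qed
    finally show ?thesis using F(3) by (simp add: k_def)
  qed
  have n1: "norm e = 1" "norm (h e) = 1" if "e \<in> E" for e
    using D(2)[OF that that] D0(2)[OF that that] by (auto simp: norm_eq_1)
  have incl: "(\<Union>z\<in>Z n. ?d z) \<subseteq> (\<Union>z\<in>Z (Suc n). ?c z)" for n
  proof
    fix v assume "v \<in> (\<Union>z\<in>Z n. ?d z)"
    then obtain z where z: "z \<in> Z n" and v: "v \<in> V" and fl: "\<And>e. e \<in> E \<Longrightarrow> \<lfloor>v \<bullet> h e\<rfloor> = z e"
      by (auto simp: cell_def)
    have "(\<Sum>e\<in>E. of_int \<lfloor>v \<bullet> h e\<rfloor> *\<^sub>R h e) = (\<Sum>e\<in>E. of_int (z e) *\<^sub>R h e)"
      by (intro sum.cong) (auto simp: fl)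
    hence "norm v \<le> norm (\<Sum>e\<in>E. of_int (z e) *\<^sub>R h e) + k"
      using near[OF v D0(1) n1(2)] norm_triangle_sub[of v "\<Sum>e\<in>E. of_int (z e) *\<^sub>R h e"] by simp
    also have "norm (\<Sum>e\<in>E. real_of_int (z e) *\<^sub>R h e) = L2_set (\<lambda>e. of_int (z e)) E"
      by (rule norm_orthonormal_sum[OF fin D0(2)])
    finally have nv: "norm v \<le> 2 * real k * real n + k" using z by (simp add: Z_def)
    define y where "y = (\<lambda>e\<in>E. \<lfloor>v \<bullet> e\<rfloor>)"
    have "L2_set (\<lambda>e. of_int (y e)) E = norm (\<Sum>e\<in>E. of_int (y e) *\<^sub>R e)"
      by (rule norm_orthonormal_sum[OF fin D(2), symmetric]) auto
    also have "(\<Sum>e\<in>E. of_int (y e) *\<^sub>R e) = (\<Sum>e\<in>E. of_int \<lfloor>v \<bullet> e\<rfloor> *\<^sub>R e)"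
      by (intro sum.cong) (auto simp: y_def)
    also have "norm \<dots> \<le> norm v + k"
      using near[OF v D(1) n1(1)] norm_triangle_sub[of "\<Sum>e\<in>E. of_int \<lfloor>v \<bullet> e\<rfloor> *\<^sub>R e" v]
      by (simp add: norm_minus_commute)
    also have "\<dots> \<le> 2 * real k * real (Suc n)" using nv by (simp add: algebra_simps)
    finally have "y \<in> Z (Suc n)" by (auto simp: Z_def y_def)
    moreover have "v \<in> ?c y" using v by (auto simp: cell_def y_def)
    ultimately show "v \<in> (\<Union>z\<in>Z (Suc n). ?c z)" by blast
  qed
  have Zext: "Z n \<subseteq> extensional E" for n by (auto simp: Z_def)
  have step: "emeasure ?\<mu> (?d (\<lambda>_. 0)) \<le> ennreal (card (Z (Suc n)) / card (Z n))" for n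
  proof (rule cell_packing[OF D0(1) finZ Zext Zne _ incl])
    show "(\<Union>z\<in>Z (Suc n). ?c z) \<in> sets borel"
      using cell_borel[OF D(1)] finZ by blast
    show "emeasure ?\<mu> (\<Union>z\<in>Z (Suc n). ?c z) \<le> ennreal (card (Z (Suc n)))"
      by (simp add: emeasure_Union_cells[OF D(1) finZ Zext] c1 ennreal_of_nat_eq_real_of_nat)
  qed simp
  then obtain r where r: "emeasure ?\<mu> (?d (\<lambda>_. 0)) = ennreal r" "0 \<le> r"
    by (metis ennreal_cases ennreal_less_top linorder_not_less top.extremum_uniqueI)
  have cpos: "card (Z n) > 0" for n using finZ Zne by (simp add: card_gt_0_iff)
  have rstep: "r * card (Z n) \<le> card (Z (Suc n))" for n
    using step[of n] r cpos[of n] by (simp add: ennreal_le_iff le_divide_eq)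
  have "r ^ n \<le> card (Z n)" for n
  proof (induction n)
    case 0
    then show ?case using cpos[of 0] by simp
  next
    case (Suc n)
    have "r ^ Suc n \<le> r * card (Z n)" using mult_left_mono[OF Suc r(2)] by simp
    also have "\<dots> \<le> card (Z (Suc n))" by (rule rstep)
    finally show ?case .
  qed
  hence "r ^ n \<le> (4 * real k * real n + 1) ^ k" for n using Zle[of n] by (meson order_trans)
  hence "r \<le> 1" by (rule geometric_le_polynomial_imp_le_1)
  thus ?thesis unfolding same r(1) by (simp add: ennreal_le_1)
qed

section \<open>Fundamental domains for integer vectors in a subspace\<close>

lemma integer_vectors_closed:
  "u \<in> integer_vectors \<Longrightarrow> v \<in> integer_vectors \<Longrightarrow> u - v \<in> integer_vectors"
  "u \<in> integer_vectors \<Longrightarrow> - u \<in> integer_vectors"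
  "u \<in> integer_vectors \<Longrightarrow> v \<in> integer_vectors \<Longrightarrow> u + v \<in> integer_vectors"
  "u \<in> integer_vectors \<Longrightarrow> of_int a *\<^sub>R u \<in> integer_vectors"
  "0 \<in> integer_vectors"
  by (auto simp: integer_vectors_def)

lemma sum_integer_vectors:
  "(\<And>j. j \<in> J \<Longrightarrow> g j \<in> integer_vectors) \<Longrightarrow> (\<Sum>j\<in>J. g j) \<in> integer_vectors"
  by (induction J rule: infinite_finite_induct) (auto simp: integer_vectors_closed)

definition floor_vec :: "(real ^ 'n) \<times> real \<Rightarrow> ('n \<Rightarrow> int) \<times> int" where
  "floor_vec v = (\<lambda>i. \<lfloor>fst v $ i\<rfloor>, \<lfloor>snd v\<rfloor>)"

lemma inj_on_floor_vec: "inj_on floor_vec (integer_vectors :: ((real ^ 'n) \<times> real) set)"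
proof (rule inj_onI)
  fix u v :: "(real ^ 'n) \<times> real"
  assume uv: "u \<in> integer_vectors" "v \<in> integer_vectors" "floor_vec u = floor_vec v"
  have *: "a = b" if "a \<in> \<int>" "b \<in> \<int>" "\<lfloor>a\<rfloor> = \<lfloor>b\<rfloor>" for a b :: real
    using that by (auto elim!: Ints_cases)
  show "u = v"
    using uv by (auto simp: floor_vec_def integer_vectors_def fun_eq_iff vec_eq_iff prod_eq_iff intro: *)
qed

lemma countable_integer_vectors: "countable (integer_vectors :: ((real ^ 'n) \<times> real) set)"
  by (rule countable_image_inj_on[OF _ inj_on_floor_vec]) simp

lemma floor_vec_diff_eq:
  assumes "l \<in> integer_vectors" "floor_vec (v - l) = floor_vec v"
  shows "l = 0"
proof -
  have "fst l $ i = 0" for i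
  proof -
    obtain k where "fst l $ i = of_int k" using assms by (auto simp: integer_vectors_def elim: Ints_cases)
    moreover have "\<lfloor>fst v $ i - fst l $ i\<rfloor> = \<lfloor>fst v $ i\<rfloor>"
      using assms by (auto simp: floor_vec_def fun_eq_iff)
    ultimately show ?thesis by simp
  qed
  moreover have "snd l = 0"
  proof -
    obtain k where "snd l = of_int k" using assms by (auto simp: integer_vectors_def elim: Ints_cases)
    moreover have "\<lfloor>snd v - snd l\<rfloor> = \<lfloor>snd v\<rfloor>"
      using assms by (auto simp: floor_vec_def)
    ultimately show ?thesis by simp
  qed
  ultimately show ?thesis by (simp add: prod_eq_iff vec_eq_iff)
qed

lemma measurable_floor_vec [measurable]:
  "(floor_vec :: (real ^ 'n::finite) \<times> real \<Rightarrow> _) \<in> measurable borel (count_space UNIV)"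
proof (subst measurable_count_space_eq2_countable, intro conjI ballI)
  fix p :: "('n \<Rightarrow> int) \<times> int"
  have "closed {v::(real^'n)\<times>real. of_int c \<le> fst v $ i}" "open {v::(real^'n)\<times>real. fst v $ i < of_int c}" for c i
    by (intro closed_Collect_le open_Collect_less continuous_intros)+
  hence 1: "{v::(real^'n)\<times>real. of_int c \<le> fst v $ i} \<in> sets borel" "{v::(real^'n)\<times>real. fst v $ i < of_int c} \<in> sets borel" for c i
    by auto
  have "closed {v::(real^'n)\<times>real. of_int c \<le> snd v}" "open {v::(real^'n)\<times>real. snd v < of_int c}" for c
    by (intro closed_Collect_le open_Collect_less continuous_intros)+
  hence 2: "{v::(real^'n)\<times>real. of_int c \<le> snd v} \<in> sets borel" "{v::(real^'n)\<times>real. snd v < of_int c} \<in> sets borel" for c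
    by auto
  have "floor_vec -` {p} \<inter> space borel =
     (\<Inter>i. {v. of_int (fst p i) \<le> fst v $ i} \<inter> {v. fst v $ i < of_int (fst p i + 1)})
      \<inter> ({v. of_int (snd p) \<le> snd v} \<inter> {v. snd v < of_int (snd p + 1)})"
    by (auto simp: floor_vec_def fun_eq_iff floor_eq_iff prod_eq_iff)
  also have "\<dots> \<in> sets borel"
    by (intro sets.Int sets.finite_INT 1 2) auto
  finally show "floor_vec -` {p} \<inter> space borel \<in> sets borel" .
qed auto

text \<open>Distinct vectors that are congruent modulo \<open>V \<inter> integer_vectors\<close> have distinct integer parts. Enumerating all
  integer parts and keeping from each class the vector whose integer part comes first gives a Borel set of representatives.\<close>

lemma fundamental_domain_exists:
  fixes V :: "((real ^ 'n) \<times> real) set"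
  assumes V: "subspace V"
  shows "\<exists>F. fundamental_domain V (V \<inter> integer_vectors) F"
proof -
  let ?\<Lambda> = "V \<inter> integer_vectors"
  define idx where "idx v = to_nat (floor_vec v)" for v :: "(real ^ 'n) \<times> real"
  define F where "F = V \<inter> (\<Inter>l\<in>?\<Lambda>. {v. idx v \<le> idx (v - l)})"
  have idx [measurable]: "(\<lambda>v. real (idx v)) \<in> borel_measurable borel"
    unfolding idx_def by (rule measurable_compose[OF measurable_floor_vec]) simp
  have "V \<in> sets borel" using closed_subspace[OF V] by (rule borel_closed)
  moreover have "{v. idx v \<le> idx (v - l)} \<in> sets borel" for l
  proof -
    have "{v \<in> space borel. real (idx v) \<le> real (idx (v - l))} \<in> sets borel"
      by measurable
    thus ?thesis by simp
  qed
  moreover have "0 \<in> ?\<Lambda>" using V by (simp add: subspace_0 integer_vectors_closed)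
  ultimately have "F \<in> sets borel"
    unfolding F_def using countable_integer_vectors
    by (intro sets.Int sets.countable_INT') auto
  moreover have "\<exists>!l. l \<in> ?\<Lambda> \<and> v - l \<in> F" if v: "v \<in> V" for v
  proof (rule ex_ex1I)
    have "\<exists>l\<in>?\<Lambda>. \<forall>l'\<in>?\<Lambda>. idx (v - l) \<le> idx (v - l')"
      using ex_has_least_nat[of "\<lambda>l. l \<in> ?\<Lambda>" 0 "\<lambda>l. idx (v - l)"] \<open>0 \<in> ?\<Lambda>\<close> by blast
    then obtain l where l: "l \<in> ?\<Lambda>" "\<And>l'. l' \<in> ?\<Lambda> \<Longrightarrow> idx (v - l) \<le> idx (v - l')" by blast
    have "idx (v - l) \<le> idx (v - l - l')" if "l' \<in> ?\<Lambda>" for l'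
      using l(2)[of "l + l'"] l(1) that V by (simp add: subspace_add integer_vectors_closed diff_diff_eq)
    moreover have "v - l \<in> V" using l(1) v V by (simp add: subspace_diff)
    ultimately have "v - l \<in> F" unfolding F_def by blast
    thus "\<exists>l. l \<in> ?\<Lambda> \<and> v - l \<in> F" using l(1) by blast
  next
    fix l l' assume l: "l \<in> ?\<Lambda> \<and> v - l \<in> F" "l' \<in> ?\<Lambda> \<and> v - l' \<in> F"
    hence d: "l' - l \<in> ?\<Lambda>" "l - l' \<in> ?\<Lambda>" using V by (auto simp: subspace_diff integer_vectors_closed)
    have "idx (v - l) \<le> idx (v - l - (l' - l))" "idx (v - l') \<le> idx (v - l' - (l - l'))"
      using l d unfolding F_def by blast+
    hence "idx (v - l - (l' - l)) = idx (v - l)" by simp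
    hence "floor_vec (v - l - (l' - l)) = floor_vec (v - l)" by (simp add: idx_def)
    hence "l' - l = 0" using d by (intro floor_vec_diff_eq[of _ "v - l"]) auto
    thus "l = l'" by simp
  qed
  ultimately have "fundamental_domain V ?\<Lambda> F" by (auto simp: fundamental_domain_def F_def)
  thus ?thesis by blast
qed

text \<open>The upper bound is the comparison of packing and covering. The covolume is positive since countably many
  translates of the fundamental domain cover a unit cube.\<close>

lemma covolume_le_covering:
  fixes V :: "((real ^ 'n) \<times> real) set"
  assumes V: "subspace V" and P: "P \<in> sets borel" "P \<subseteq> V"
    and cover: "\<And>v. v \<in> V \<Longrightarrow> \<exists>l\<in>V \<inter> integer_vectors. v - l \<in> P"
    and c: "emeasure (subspace_lborel V) P \<le> ennreal c" "0 \<le> c"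
  shows "0 < covolume V (V \<inter> integer_vectors)" "covolume V (V \<inter> integer_vectors) \<le> c"
proof -
  let ?\<Lambda> = "V \<inter> integer_vectors" and ?\<mu> = "subspace_lborel V"
  define F where "F = (SOME F. fundamental_domain V ?\<Lambda> F)"
  have F: "fundamental_domain V ?\<Lambda> F"
    unfolding F_def using fundamental_domain_exists[OF V] by (rule someI_ex)
  hence Fb: "F \<in> sets borel" "F \<subseteq> V"
    and Fu: "\<And>v l l'. v \<in> V \<Longrightarrow> l \<in> ?\<Lambda> \<Longrightarrow> l' \<in> ?\<Lambda> \<Longrightarrow> v - l \<in> F \<Longrightarrow> v - l' \<in> F \<Longrightarrow> l = l'"
    and Fe: "\<And>v. v \<in> V \<Longrightarrow> \<exists>l\<in>?\<Lambda>. v - l \<in> F"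
    unfolding fundamental_domain_def by blast+
  have cnt: "countable ?\<Lambda>" using countable_integer_vectors by blast
  have "emeasure ?\<mu> F \<le> emeasure ?\<mu> P"
  proof (rule packing_le_covering[OF V cnt _ Fb(1) P(1) _ P(2)])
    show "- l \<in> ?\<Lambda>" if "l \<in> ?\<Lambda>" for l using that V by (simp add: subspace_neg integer_vectors_closed)
  qed (use Fu cover Fb in blast)+
  hence le: "emeasure ?\<mu> F \<le> ennreal c" using c by simp
  have "emeasure ?\<mu> F \<noteq> 0"
  proof
    assume 0: "emeasure ?\<mu> F = 0"
    obtain E where E: "orthonormal_basis V E"
      and eq: "subspace_lborel V = distr (Pi\<^sub>M E (\<lambda>_. lborel :: real measure)) borel (\<lambda>f. \<Sum>e\<in>E. f e *\<^sub>R e)"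
      using subspace_lborel_basis[OF V] .
    have null: "{v. - l + v \<in> F} \<in> null_sets ?\<mu>" if "l \<in> ?\<Lambda>" for l
    proof -
      have "- l \<in> V" using that V by (simp add: subspace_neg)
      moreover have "{v. - l + v \<in> F} \<in> sets borel" using Fb(1) by measurable
      ultimately show ?thesis
        using subspace_lborel_translation[OF V _ Fb(1), of "- l"] 0 by (simp add: null_sets_def)
    qed
    have "(\<Union>l\<in>?\<Lambda>. {v. - l + v \<in> F}) \<in> null_sets ?\<mu>"
      by (rule null_sets_UN'[OF cnt null])
    moreover have "{v\<in>V. \<forall>e\<in>E. v \<bullet> e \<in> {0..1}} \<subseteq> (\<Union>l\<in>?\<Lambda>. {v. - l + v \<in> F})"
      using Fe by force
    ultimately have "emeasure ?\<mu> {v\<in>V. \<forall>e\<in>E. v \<bullet> e \<in> {0..1}} = 0"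
      by (metis (no_types, lifting) emeasure_mono le_zero_eq null_setsD1 null_setsD2)
    thus False using subspace_lborel_cube(1)[OF E eq, of 0 1] by simp
  qed
  moreover have cov: "covolume V ?\<Lambda> = measure ?\<mu> F" by (simp add: covolume_def F_def)
  moreover have fin: "emeasure ?\<mu> F < \<infinity>" using le by (simp add: le_less_trans)
  ultimately show "0 < covolume V ?\<Lambda>"
    by (simp add: measure_def enn2real_positive_iff zero_less_iff_neq_zero)
  show "covolume V ?\<Lambda> \<le> c"
    unfolding cov measure_def using le c by (simp add: enn2real_leI)
qed

section \<open>Affine subspaces as sections of linear subspaces\<close>

text \<open>The vectors of \<open>V\<close> at height \<open>1\<close> span \<open>V\<close> as soon as there is one: any other vector of \<open>V\<close> becomes such a vector
  after adding a multiple of it.\<close>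

lemma dehomogenize:
  fixes V :: "((real ^ 'n) \<times> real) set"
  assumes V: "subspace V" and v: "v \<in> V" "snd v \<noteq> 0" and d: "dim V = d + 1"
  defines "L \<equiv> {y. (y, 1) \<in> V}"
  shows "affine L" "aff_dim L = int d" "homogenization L = V"
    "(1 / snd v) *\<^sub>R fst v \<in> L"
proof -
  show aff: "affine L"
    unfolding affine_def
  proof (intro ballI allI impI)
    fix x y u w assume xy: "x \<in> L" "y \<in> L" "u + w = (1::real)"
    hence "u *\<^sub>R (x, 1) + w *\<^sub>R (y, 1) \<in> V"
      unfolding L_def using V by (intro subspace_add subspace_scale) auto
    thus "u *\<^sub>R x + w *\<^sub>R y \<in> L" using xy by (simp add: L_def)
  qed
  define p where "p = (1 / snd v) *\<^sub>R fst v"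
  have "(1 / snd v) *\<^sub>R v \<in> V" using V v by (simp add: subspace_scale)
  moreover have "(1 / snd v) *\<^sub>R v = (p, 1)" using v by (simp add: p_def prod_eq_iff)
  ultimately show p: "(1 / snd v) *\<^sub>R fst v \<in> L" by (simp add: L_def p_def)
  hence ne: "L \<noteq> {}" by blast
  have pl: "(p, 1) \<in> lifted L" using p by (auto simp: lifted_def p_def)
  have "span (lifted L) = V"
  proof
    show "span (lifted L) \<subseteq> V"
      by (rule span_minimal) (auto simp: lifted_def L_def V)
    show "V \<subseteq> span (lifted L)"
    proof
      fix w assume w: "w \<in> V"
      have "w + (1 - snd w) *\<^sub>R (p, 1) \<in> V"
        using V w \<open>(1 / snd v) *\<^sub>R v \<in> V\<close> \<open>(1 / snd v) *\<^sub>R v = (p, 1)\<close>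
        by (simp only: subspace_add subspace_scale)
      hence "w + (1 - snd w) *\<^sub>R (p, 1) \<in> lifted L"
        by (auto simp: lifted_def L_def image_iff prod_eq_iff intro!: exI[of _ "fst w + (1 - snd w) *\<^sub>R p"] elim!: back_subst[of "\<lambda>x. x \<in> V"])
      hence "(w + (1 - snd w) *\<^sub>R (p, 1)) - (1 - snd w) *\<^sub>R (p, 1) \<in> span (lifted L)"
        using pl by (intro span_diff span_scale span_base)
      thus "w \<in> span (lifted L)" by simp
    qed
  qed
  thus "homogenization L = V" using homogenization_eq_span[OF aff ne] by simp
  show "aff_dim L = int d"
    using dim_span_lifted[OF aff ne] \<open>span (lifted L) = V\<close> d by simp
qed

section \<open>Successive minima\<close>

text \<open>Gram--Schmidt orthonormalisation of a sequence, keeping track of all initial spans.\<close>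

lemma orthonormal_flag:
  fixes w :: "nat \<Rightarrow> 'a::euclidean_space"
  assumes "\<And>j. j < m \<Longrightarrow> w j \<notin> span (w ` {..<j})"
  shows "\<exists>e. (\<forall>j\<le>m. span (e ` {..<j}) = span (w ` {..<j})) \<and>
     (\<forall>i<m. \<forall>j<m. e i \<bullet> e j = (if i = j then 1 else 0))"
  (is "\<exists>e. ?P m e")
  using assms
proof (induction m)
  case 0
  then show ?case by auto
next
  case (Suc m)
  have "\<exists>e. ?P m e" by (rule Suc.IH) (simp add: Suc.prems)
  then obtain e where e: "?P m e" ..
  hence sp: "\<And>j. j \<le> m \<Longrightarrow> span (e ` {..<j}) = span (w ` {..<j})"
    and on: "\<And>i j. i < m \<Longrightarrow> j < m \<Longrightarrow> e i \<bullet> e j = (if i = j then 1 else 0)"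
    by auto
  define p where "p = (\<Sum>i<m. (w m \<bullet> e i) *\<^sub>R e i)"
  define u where "u = w m - p"
  have p: "p \<in> span (e ` {..<m})"
    unfolding p_def by (intro span_sum span_scale span_base) auto
  have "u \<noteq> 0" using Suc.prems[of m] sp[of m] p by (auto simp: u_def)
  have ue: "u \<bullet> e j = 0" if "j < m" for j
  proof -
    have "p \<bullet> e j = (\<Sum>i<m. if i = j then w m \<bullet> e i else 0)"
      unfolding p_def inner_sum_left by (intro sum.cong) (auto simp: on that)
    thus ?thesis using that by (simp add: u_def inner_diff_left)
  qed
  define e' where "e' = e(m := (1 / norm u) *\<^sub>R u)"
  have im: "e' ` {..<j} = e ` {..<j}" if "j \<le> m" for j
    using that by (auto simp: e'_def)
  have "span (e' ` {..<Suc m}) = span (insert ((1 / norm u) *\<^sub>R u) (e ` {..<m}))"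
    by (simp only: lessThan_Suc image_insert im[OF order_refl]) (simp add: e'_def)
  also have "\<dots> = span (insert (w m) (e ` {..<m}))"
  proof (rule span_eq[THEN iffD2], intro conjI insert_subsetI)
    have "w m = norm u *\<^sub>R ((1 / norm u) *\<^sub>R u) + p" using \<open>u \<noteq> 0\<close> by (simp add: u_def)
    also have "\<dots> \<in> span (insert ((1 / norm u) *\<^sub>R u) (e ` {..<m}))"
      using subsetD[OF span_mono p]
      by (intro span_add[OF span_scale[OF span_base]]) auto
    finally show "w m \<in> span (insert ((1 / norm u) *\<^sub>R u) (e ` {..<m}))" .
    show "(1 / norm u) *\<^sub>R u \<in> span (insert (w m) (e ` {..<m}))"
      unfolding u_def using subsetD[OF span_mono p]
      by (intro span_scale span_diff[OF span_base]) auto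
  qed (auto intro: span_base)
  also have "\<dots> = span (w ` {..<Suc m})"
    using sp[of m] by (simp add: lessThan_Suc span_insert)
  finally have "\<forall>j\<le>Suc m. span (e' ` {..<j}) = span (w ` {..<j})"
    using sp im by (auto simp: le_Suc_eq)
  moreover have "u \<bullet> u = norm u * norm u" by (simp add: dot_square_norm power2_eq_square)
  hence "\<forall>i<Suc m. \<forall>j<Suc m. e' i \<bullet> e' j = (if i = j then 1 else 0)"
    using on ue \<open>u \<noteq> 0\<close> by (auto simp: e'_def less_Suc_eq inner_commute)
  ultimately show ?case by blast
qed

text \<open>The vectors realising the successive minima of the Euclidean ball with respect to \<open>\<Gamma>\<close>, chosen greedily.\<close>

definition successive_minima :: "'a::euclidean_space set \<Rightarrow> (nat \<Rightarrow> 'a) \<Rightarrow> nat \<Rightarrow> bool" where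
  "successive_minima \<Gamma> w m \<longleftrightarrow> (\<forall>j<m. w j \<in> \<Gamma> \<and> w j \<notin> span (w ` {..<j}) \<and>
     (\<forall>g\<in>\<Gamma>. g \<notin> span (w ` {..<j}) \<longrightarrow> norm (w j) \<le> norm g))"

lemma successive_minima_exist:
  fixes \<Gamma> :: "'a::euclidean_space set"
  assumes sp: "span \<Gamma> = UNIV" and disc: "\<And>r. finite {g\<in>\<Gamma>. norm g \<le> r}" and m: "m \<le> DIM('a)"
  shows "\<exists>w. successive_minima \<Gamma> w m"
  using m
proof (induction m)
  case 0
  then show ?case by (auto simp: successive_minima_def)
next
  case (Suc m)
  then obtain w where w: "successive_minima \<Gamma> w m" by auto
  have "dim (w ` {..<m}) \<le> card (w ` {..<m})" by (rule dim_le_card') simp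
  also have "\<dots> \<le> m" using card_image_le[of "{..<m}" w] by simp
  finally have "span (w ` {..<m}) \<noteq> UNIV" using Suc.prems by (metis dim_UNIV dim_span not_less_eq_eq)
  hence "\<not> \<Gamma> \<subseteq> span (w ` {..<m})" using sp by (metis span_mono span_span top.extremum_uniqueI)
  then obtain g where g: "g \<in> \<Gamma>" "g \<notin> span (w ` {..<m})" by blast
  let ?S = "{h\<in>\<Gamma>. norm h \<le> norm g} - span (w ` {..<m})"
  have "finite ?S" "g \<in> ?S" using disc g by auto
  define h where "h = arg_min_on norm ?S"
  have "?S \<noteq> {}" using \<open>g \<in> ?S\<close> by blast
  from arg_min_if_finite[OF \<open>finite ?S\<close> this, of norm]
  have h: "h \<in> ?S" "\<And>h'. h' \<in> ?S \<Longrightarrow> norm h \<le> norm h'"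
    unfolding h_def not_less[symmetric] by blast+
  have "norm h \<le> norm h'" if "h' \<in> \<Gamma>" "h' \<notin> span (w ` {..<m})" for h'
    using h(1) h(2)[of h'] that by force
  moreover define w' where "w' = w(m := h)"
  hence "w' m = h" "\<And>j. j < m \<Longrightarrow> w' j = w j" "\<And>j. j \<le> m \<Longrightarrow> w' ` {..<j} = w ` {..<j}"
    by auto
  ultimately have "successive_minima \<Gamma> w' (Suc m)"
    using w h(1) by (auto simp: successive_minima_def less_Suc_eq)
  thus ?case by blast
qed

lemma successive_minima_mono:
  assumes "successive_minima \<Gamma> w m" "i \<le> j" "j < m"
  shows "norm (w i) \<le> norm (w j)"
proof -
  have "w j \<notin> span (w ` {..<i})"
    using assms span_mono[of "w ` {..<i}" "w ` {..<j}"]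
    by (force simp: successive_minima_def)
  thus ?thesis using assms by (auto simp: successive_minima_def)
qed

lemma flag_inj_independent:
  fixes v :: "nat \<Rightarrow> 'a::euclidean_space"
  assumes ind: "\<And>j. j < k \<Longrightarrow> v j \<notin> span (v ` {..<j})"
  shows "inj_on v {..<k}" "independent (v ` {..<k})"
proof -
  show "inj_on v {..<k}"
  proof (rule linorder_inj_onI')
    fix i j assume "i \<in> {..<k}" "j \<in> {..<k}" "i < j"
    thus "v i \<noteq> v j" using ind[of j] span_base[of "v i" "v ` {..<j}"] by auto
  qed
  have "independent (v ` {..<j})" if "j \<le> k" for j
    using that
  proof (induction j)
    case (Suc j)
    have "v ` {..<Suc j} = insert (v j) (v ` {..<j})" by (auto simp: less_Suc_eq)
    thus ?case using Suc ind[of j] by (simp add: independent_insertI)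
  qed (simp add: independent_empty)
  thus "independent (v ` {..<k})" by simp
qed

text \<open>The counting form of the upper bound in Minkowski's second theorem. Take coordinates with respect to the orthonormal
  flag of \<open>w\<close>. If \<open>g \<noteq> 0\<close> lies in the span of \<open>w 0, ..., w i\<close> but not of \<open>w 0, ..., w (i - 1)\<close>, then its norm is at
  least \<open>\<mu> i\<close>, whereas coordinates below \<open>\<mu> l / m\<close> would make it smaller. So lattice points with norm at most \<open>R\<close> are
  separated by a grid of boxes with sides \<open>\<mu> l / m\<close>, and only about \<open>R ^ m / (\<Prod>l. \<mu> l)\<close> boxes are available.\<close>

lemma minkowski_counting:
  fixes \<Gamma> :: "'a::euclidean_space set" and R :: real
  assumes diff: "\<And>g h. g \<in> \<Gamma> \<Longrightarrow> h \<in> \<Gamma> \<Longrightarrow> g - h \<in> \<Gamma>"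
    and w: "successive_minima \<Gamma> w DIM('a)"
    and R: "norm (w (DIM('a) - 1)) \<le> R"
  shows "real (card {g\<in>\<Gamma>. norm g \<le> R}) * (\<Prod>j<DIM('a). norm (w j)) \<le> (4 * real DIM('a) * R) ^ DIM('a)"
proof -
  define m where "m = DIM('a)"
  have m: "m > 0" by (simp add: m_def)
  define \<mu> where "\<mu> j = norm (w j)" for j
  have ind: "w j \<notin> span (w ` {..<j})" if "j < m" for j
    using w that by (auto simp: successive_minima_def m_def)
  have minm: "\<mu> j \<le> norm g" if "j < m" "g \<in> \<Gamma>" "g \<notin> span (w ` {..<j})" for j g
    using w that by (auto simp: successive_minima_def m_def \<mu>_def)
  have mono: "\<mu> i \<le> \<mu> j" if "i \<le> j" "j < m" for i j
    using successive_minima_mono[OF w] that by (simp add: \<mu>_def m_def)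
  have pos: "\<mu> j > 0" if "j < m" for j
    using ind[OF that] span_zero[of "w ` {..<j}"] by (auto simp: \<mu>_def)
  have leR: "\<mu> j \<le> R" if "j < m" for j
  proof -
    have "j \<le> m - 1" "m - 1 < m" using that m by auto
    from mono[OF this] show ?thesis using R by (simp add: \<mu>_def m_def)
  qed
  obtain e where e: "(\<forall>j\<le>m. span (e ` {..<j}) = span (w ` {..<j})) \<and>
     (\<forall>i<m. \<forall>j<m. e i \<bullet> e j = (if i = j then 1 else 0))"
    using orthonormal_flag[of m w, OF ind] ..
  hence sp: "\<And>j. j \<le> m \<Longrightarrow> span (e ` {..<j}) = span (w ` {..<j})"
    and on: "\<And>i j. i < m \<Longrightarrow> j < m \<Longrightarrow> e i \<bullet> e j = (if i = j then 1 else 0)"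
    by auto
  have expand: "(norm g)\<^sup>2 = (\<Sum>l<j. (g \<bullet> e l)\<^sup>2)" if g: "g \<in> span (w ` {..<j})" and j: "j \<le> m" for g j
  proof -
    have "g \<in> span (e ` {..<j})" using g sp[OF j] by simp
    hence "(\<Sum>l<j. (g \<bullet> e l) *\<^sub>R e l) = g"
    proof (induction rule: span_induct_alt)
      case base
      then show ?case by simp
    next
      case (step c x y)
      then obtain i where i: "i < j" "x = e i" by auto
      have "(\<Sum>l<j. (x \<bullet> e l) *\<^sub>R e l) = (\<Sum>l<j. if l = i then e l else 0)"
        using i j on by (intro sum.cong) auto
      hence "(\<Sum>l<j. (x \<bullet> e l) *\<^sub>R e l) = x" using i by simp
      moreover have "(\<Sum>l<j. ((c *\<^sub>R x + y) \<bullet> e l) *\<^sub>R e l)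
          = c *\<^sub>R (\<Sum>l<j. (x \<bullet> e l) *\<^sub>R e l) + (\<Sum>l<j. (y \<bullet> e l) *\<^sub>R e l)"
        by (simp add: inner_add_left scaleR_left_distrib sum.distrib scaleR_sum_right)
      ultimately show ?case using step.IH by simp
    qed
    hence "g \<bullet> g = g \<bullet> (\<Sum>l<j. (g \<bullet> e l) *\<^sub>R e l)" by simp
    also have "\<dots> = (\<Sum>l<j. (g \<bullet> e l)\<^sup>2)"
      by (simp add: inner_sum_right power2_eq_square)
    finally show ?thesis by (simp add: dot_square_norm)
  qed
  have full: "span (w ` {..<m}) = UNIV"
  proof -
    have "dim (w ` {..<m}) = DIM('a)"
      using flag_inj_independent[of m w, OF ind] by (simp add: dim_eq_card_independent card_image m_def)
    thus ?thesis by (simp add: dim_eq_full)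
  qed
  have empty: "g = 0" if g: "g \<in> \<Gamma>" and small: "\<And>l. l < m \<Longrightarrow> \<bar>g \<bullet> e l\<bar> < \<mu> l / m" for g
  proof (rule ccontr)
    assume "g \<noteq> 0"
    define j where "j = (LEAST j. g \<in> span (w ` {..<j}))"
    have gm: "g \<in> span (w ` {..<m})" using full by simp
    have gj: "g \<in> span (w ` {..<j})" unfolding j_def using gm by (rule LeastI)
    have "j \<le> m" unfolding j_def using gm by (rule Least_le)
    have "j \<noteq> 0" using gj \<open>g \<noteq> 0\<close> by (cases "j = 0") auto
    then obtain i where i: "j = Suc i" by (cases j) auto
    hence "g \<notin> span (w ` {..<i})" using not_less_Least[of i "\<lambda>j. g \<in> span (w ` {..<j})"] by (simp add: j_def)
    hence "\<mu> i \<le> norm g" using minm[of i g] g \<open>j \<le> m\<close> i by simp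
    hence "(\<mu> i)\<^sup>2 \<le> (norm g)\<^sup>2" using pos[of i] i \<open>j \<le> m\<close> by (intro power_mono) auto
    also have "\<dots> = (\<Sum>l<j. (g \<bullet> e l)\<^sup>2)" by (rule expand[OF gj \<open>j \<le> m\<close>])
    also have "\<dots> < (\<Sum>l<j. (\<mu> i / m)\<^sup>2)"
    proof (rule sum_strict_mono)
      fix l assume l: "l \<in> {..<j}"
      hence "\<bar>g \<bullet> e l\<bar> < \<mu> l / m" using i \<open>j \<le> m\<close> by (intro small) auto
      also have "\<dots> \<le> \<mu> i / m" using l i \<open>j \<le> m\<close> by (intro divide_right_mono mono) auto
      finally show "(g \<bullet> e l)\<^sup>2 < (\<mu> i / m)\<^sup>2"
        using power_strict_mono[of "\<bar>g \<bullet> e l\<bar>" "\<mu> i / m" 2] by simp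
    qed (use \<open>j \<noteq> 0\<close> in auto)
    also have "\<dots> = real j * ((\<mu> i)\<^sup>2 / (real m)\<^sup>2)" by (simp add: power_divide)
    also have "\<dots> \<le> real m * real m * ((\<mu> i)\<^sup>2 / (real m)\<^sup>2)"
    proof (rule mult_right_mono)
      have "real j * 1 \<le> real m * real m" using \<open>j \<le> m\<close> m by (intro mult_mono) auto
      thus "real j \<le> real m * real m" by simp
    qed simp
    also have "\<dots> = (\<mu> i)\<^sup>2" using m by (simp add: power2_eq_square)
    finally show False by simp
  qed
  define S where "S = {g\<in>\<Gamma>. norm g \<le> R}"
  define \<phi> where "\<phi> g = (\<lambda>l\<in>{..<m}. \<lfloor>(g \<bullet> e l) * m / \<mu> l\<rfloor>)" for g
  \<comment> \<open>The \<open>l\<close>-th grid coordinate of a point of norm at most \<open>R\<close> lies between \<open>- q l\<close> and \<open>q l\<close>.\<close>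
  define q where "q l = R * m / \<mu> l" for l
  have q1: "q l \<ge> 1" if "l < m" for l
  proof -
    have "\<mu> l * 1 \<le> R * m" using leR[OF that] pos[OF that] m by (intro mult_mono) auto
    thus ?thesis using pos[OF that] by (simp add: q_def)
  qed
  have "inj_on \<phi> S"
  proof (rule inj_onI)
    fix g h assume gh: "g \<in> S" "h \<in> S" "\<phi> g = \<phi> h"
    have "g - h = 0"
    proof (rule empty)
      show "g - h \<in> \<Gamma>" using gh diff by (simp add: S_def)
      fix l assume l: "l < m"
      have "\<lfloor>(g \<bullet> e l) * m / \<mu> l\<rfloor> = \<lfloor>(h \<bullet> e l) * m / \<mu> l\<rfloor>"
        using fun_cong[OF gh(3), of l] l by (simp add: \<phi>_def)
      hence "\<bar>(g \<bullet> e l) * m / \<mu> l - (h \<bullet> e l) * m / \<mu> l\<bar> < 1" by linarith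
      also have "(g \<bullet> e l) * m / \<mu> l - (h \<bullet> e l) * m / \<mu> l = ((g - h) \<bullet> e l) * (m / \<mu> l)"
        by (simp add: inner_diff_left diff_divide_distrib left_diff_distrib)
      finally have "\<bar>(g - h) \<bullet> e l\<bar> * (m / \<mu> l) < 1" using pos[OF l] by (simp add: abs_mult)
      thus "\<bar>(g - h) \<bullet> e l\<bar> < \<mu> l / m" using pos[OF l] m by (simp add: field_simps)
    qed
    thus "g = h" by simp
  qed
  moreover have sub: "\<phi> ` S \<subseteq> Pi\<^sub>E {..<m} (\<lambda>l. {\<lfloor>- q l\<rfloor>..\<lfloor>q l\<rfloor>})"
  proof (rule image_subsetI)
    fix g assume g: "g \<in> S"
    have "\<lfloor>(g \<bullet> e l) * m / \<mu> l\<rfloor> \<in> {\<lfloor>- q l\<rfloor>..\<lfloor>q l\<rfloor>}" if l: "l < m" for l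
    proof -
      have "norm (e l) = 1" using on[OF l l] by (simp add: norm_eq_1)
      hence "\<bar>g \<bullet> e l\<bar> \<le> R" using Cauchy_Schwarz_ineq2[of g "e l"] g by (simp add: S_def)
      hence "- R \<le> g \<bullet> e l" "g \<bullet> e l \<le> R" by linarith+
      hence "- q l \<le> (g \<bullet> e l) * m / \<mu> l" "(g \<bullet> e l) * m / \<mu> l \<le> q l"
        using pos[OF l] unfolding q_def minus_divide_left minus_mult_left
        by (intro divide_right_mono mult_right_mono; simp)+
      thus ?thesis by (auto intro: floor_mono)
    qed
    thus "\<phi> g \<in> Pi\<^sub>E {..<m} (\<lambda>l. {\<lfloor>- q l\<rfloor>..\<lfloor>q l\<rfloor>})" by (auto simp: \<phi>_def)
  qed
  ultimately have "card S \<le> card (Pi\<^sub>E {..<m} (\<lambda>l. {\<lfloor>- q l\<rfloor>..\<lfloor>q l\<rfloor>}))"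
    by (intro card_inj_on_le[of \<phi>]) (auto intro!: finite_PiE)
  also have "\<dots> = (\<Prod>l<m. card {\<lfloor>- q l\<rfloor>..\<lfloor>q l\<rfloor>})" by (simp add: card_PiE)
  finally have "real (card S) \<le> (\<Prod>l<m. real (card {\<lfloor>- q l\<rfloor>..\<lfloor>q l\<rfloor>}))"
    by (metis of_nat_le_iff of_nat_prod)
  also have "\<dots> \<le> (\<Prod>l<m. 4 * q l)"
  proof (rule prod_mono, intro conjI)
    fix l assume "l \<in> {..<m}"
    hence "q l \<ge> 1" using q1 by simp
    thus "real (card {\<lfloor>- q l\<rfloor>..\<lfloor>q l\<rfloor>}) \<le> 4 * q l"
      unfolding card_atLeastAtMost_int by linarith
  qed simp
  finally have "real (card S) * (\<Prod>j<m. \<mu> j) \<le> (\<Prod>l<m. 4 * q l) * (\<Prod>j<m. \<mu> j)"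
    using pos by (intro mult_right_mono prod_nonneg) (auto simp: less_imp_le)
  also have "\<dots> = (\<Prod>l<m. 4 * q l * \<mu> l)" by (simp add: prod.distrib)
  also have "\<dots> = (\<Prod>l<m. 4 * m * R)"
  proof (rule prod.cong)
    fix l assume "l \<in> {..<m}"
    thus "4 * q l * \<mu> l = 4 * m * R" using pos[of l] by (simp add: q_def)
  qed simp
  finally show ?thesis by (simp add: S_def m_def \<mu>_def)
qed

section \<open>The sheared integer lattice\<close>

lemma finite_bounded_integer_vectors:
  "finite {v \<in> integer_vectors :: ((real ^ 'n) \<times> real) set. norm v \<le> r}"
proof -
  define c where "c = \<lceil>\<bar>r\<bar>\<rceil> + 1"
  let ?S = "{v \<in> integer_vectors :: ((real ^ 'n) \<times> real) set. norm v \<le> r}"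
  have "floor_vec ` ?S \<subseteq> Pi\<^sub>E UNIV (\<lambda>_. {- c..c}) \<times> {- c..c}"
  proof (rule image_subsetI)
    fix v :: "(real ^ 'n) \<times> real" assume v: "v \<in> ?S"
    have fl: "\<lfloor>a\<rfloor> \<in> {- c..c}" if "\<bar>a\<bar> \<le> r" for a :: real
      using that unfolding c_def atLeastAtMost_iff by linarith
    have "\<bar>fst v $ i\<bar> \<le> r" for i
      using component_le_norm_cart[of "fst v" i] norm_fst_le[of "fst v" "snd v"] v by simp
    moreover have "\<bar>snd v\<bar> \<le> r"
      using norm_snd_le[of "snd v" "fst v"] v by simp
    ultimately show "floor_vec v \<in> Pi\<^sub>E UNIV (\<lambda>_. {- c..c}) \<times> {- c..c}"
      unfolding floor_vec_def using fl by auto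
  qed
  moreover have "finite (Pi\<^sub>E (UNIV :: 'n set) (\<lambda>_. {- c..c}) \<times> {- c..c})"
    by (intro finite_cartesian_product finite_PiE) auto
  ultimately have "finite (floor_vec ` ?S)" by (rule finite_subset)
  moreover have "inj_on floor_vec ?S" using inj_on_floor_vec by (rule inj_on_subset) auto
  ultimately show ?thesis by (rule finite_imageD)
qed

text \<open>A unimodular map for which \<open>v\<close> has small image exactly if \<open>fst v\<close> is close to \<open>snd v *\<^sub>R x\<close> and \<open>snd v\<close> is not
  too large. The exponent makes the determinant \<open>1\<close>.\<close>

definition scaled_shear :: "real ^ 'n \<Rightarrow> real \<Rightarrow> (real ^ 'n) \<times> real \<Rightarrow> (real ^ 'n) \<times> real" where
  "scaled_shear x T v = (T *\<^sub>R (fst v - snd v *\<^sub>R x), snd v / T ^ CARD('n))"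

lemma linear_scaled_shear: "linear (scaled_shear x T)"
  by (rule linearI) (auto simp: scaled_shear_def algebra_simps add_divide_distrib)

lemma inj_scaled_shear: "T > 0 \<Longrightarrow> inj (scaled_shear x T)"
  by (rule injI) (auto simp: scaled_shear_def prod_eq_iff)

lemma span_integer_vectors: "span integer_vectors = (UNIV :: ((real ^ 'n) \<times> real) set)"
proof -
  have "Basis \<subseteq> (integer_vectors :: ((real ^ 'n) \<times> real) set)"
    by (auto simp: Basis_prod_def integer_vectors_def Basis_vec_def axis_def)
  hence "span Basis \<subseteq> span (integer_vectors :: ((real ^ 'n) \<times> real) set)" by (rule span_mono)
  thus ?thesis by (simp add: top.extremum_uniqueI)
qed

lemma finite_scaled_shear_ball:
  fixes x :: "real ^ 'n"
  assumes T: "T > 0"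
  shows "finite {g \<in> scaled_shear x T ` integer_vectors. norm g \<le> r}"
proof -
  obtain B where B: "B > 0" "\<And>v. B * norm v \<le> norm (scaled_shear x T v)"
    using linear_inj_bounded_below_pos[OF linear_scaled_shear inj_scaled_shear[OF T]] by blast
  have "{g \<in> scaled_shear x T ` integer_vectors. norm g \<le> r}
      \<subseteq> scaled_shear x T ` {v \<in> integer_vectors. norm v \<le> r / B}"
  proof
    fix g assume "g \<in> {g \<in> scaled_shear x T ` integer_vectors. norm g \<le> r}"
    then obtain v where v: "v \<in> integer_vectors" "norm (scaled_shear x T v) \<le> r" "g = scaled_shear x T v"
      by blast
    have "norm v \<le> r / B" using B(2)[of v] v(2) B(1) by (simp add: le_divide_eq mult.commute)
    thus "g \<in> scaled_shear x T ` {v \<in> integer_vectors. norm v \<le> r / B}"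
      using v by blast
  qed
  thus ?thesis by (rule finite_subset) (intro finite_imageI finite_bounded_integer_vectors)
qed

text \<open>The count that replaces the volume of the image lattice. Choose an integer \<open>t\<close> with \<open>0 \<le> t \<le> T^n M T\<close>, and for
  each coordinate \<open>i\<close> one of the \<open>M\<close> consecutive integers starting at the integer part of \<open>t * x $ i\<close>.\<close>

lemma many_lattice_points:
  fixes x :: "real ^ 'n"
  assumes T: "T > 0" and M: "M \<ge> (1::nat)"
  defines "n \<equiv> CARD('n)"
  shows "(real M * T) ^ (n + 1) \<le>
     real (card {g \<in> scaled_shear x T ` integer_vectors. norm g \<le> real (n + 1) * (real M * T)})"
proof -
  let ?\<Gamma> = "scaled_shear x T ` integer_vectors"
  define \<rho> where "\<rho> = real M * T"
  define K where "K = nat \<lceil>T ^ n * \<rho>\<rceil>"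
  have \<rho>: "\<rho> > 0" using T M by (simp add: \<rho>_def)
  define pt where "pt p = ((\<chi> i. real_of_int \<lfloor>real (snd p) * x $ i\<rfloor> + real (fst p i)) :: real ^ 'n, real (snd p))"
    for p :: "('n \<Rightarrow> nat) \<times> nat"
  let ?D = "Pi\<^sub>E UNIV (\<lambda>_. {..<M}) \<times> {..<K} :: (('n \<Rightarrow> nat) \<times> nat) set"
  have "inj_on (scaled_shear x T \<circ> pt) ?D"
  proof (rule comp_inj_on)
    show "inj_on pt ?D" by (auto simp: inj_on_def pt_def vec_eq_iff fun_eq_iff)
  qed (use inj_scaled_shear[OF T] in \<open>auto intro: inj_on_subset\<close>)
  moreover have "(scaled_shear x T \<circ> pt) ` ?D \<subseteq> {g \<in> ?\<Gamma>. norm g \<le> real (n + 1) * \<rho>}"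
  proof (rule image_subsetI)
    fix p assume p: "p \<in> ?D"
    have "pt p \<in> integer_vectors" by (auto simp: pt_def integer_vectors_def)
    moreover have "norm (scaled_shear x T (pt p)) \<le> real (n + 1) * \<rho>"
    proof -
      have "\<bar>(fst (pt p) - snd (pt p) *\<^sub>R x) $ i\<bar> \<le> real M" for i
      proof -
        have "fst p i < M" using p by auto
        hence "real (fst p i) + 1 \<le> real M" by linarith
        thus ?thesis unfolding pt_def by simp linarith
      qed
      hence "norm (fst (pt p) - snd (pt p) *\<^sub>R x) \<le> (\<Sum>i\<in>(UNIV :: 'n set). real M)"
        by (intro order.trans[OF norm_le_l1_cart] sum_mono)
      also have "\<dots> = real n * real M" by (simp add: n_def)
      finally have "T * norm (fst (pt p) - snd (pt p) *\<^sub>R x) \<le> T * (real n * real M)"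
        using T by (intro mult_left_mono) auto
      hence 1: "norm (fst (scaled_shear x T (pt p))) \<le> real n * \<rho>"
        using T by (simp add: scaled_shear_def \<rho>_def mult_ac)
      have "snd p < K" using p by auto
      hence "real (snd p) \<le> T ^ n * \<rho>" unfolding K_def by linarith
      hence 2: "norm (snd (scaled_shear x T (pt p))) \<le> \<rho>"
        using T by (simp add: scaled_shear_def pt_def n_def divide_le_eq mult.commute)
      have "norm (scaled_shear x T (pt p)) \<le> norm (fst (scaled_shear x T (pt p))) + norm (snd (scaled_shear x T (pt p)))"
        using norm_Pair_le[of "fst (scaled_shear x T (pt p))" "snd (scaled_shear x T (pt p))"] by simp
      thus ?thesis using 1 2 by (simp add: algebra_simps)
    qed
    ultimately show "(scaled_shear x T \<circ> pt) p \<in> {g \<in> ?\<Gamma>. norm g \<le> real (n + 1) * \<rho>}" by simp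
  qed
  moreover have "finite {g \<in> ?\<Gamma>. norm g \<le> real (n + 1) * \<rho>}" by (rule finite_scaled_shear_ball[OF T])
  ultimately have le: "card ?D \<le> card {g \<in> ?\<Gamma>. norm g \<le> real (n + 1) * \<rho>}"
    by (rule card_inj_on_le)
  have cD: "card ?D = M ^ n * K" by (simp add: card_cartesian_product card_PiE n_def)
  have "T ^ n * \<rho> \<le> real K" unfolding K_def by linarith
  hence "real M ^ n * (T ^ n * \<rho>) \<le> real M ^ n * real K" by (intro mult_left_mono) auto
  hence "\<rho> ^ (n + 1) \<le> real (M ^ n * K)" by (simp add: \<rho>_def power_mult_distrib mult_ac)
  also have "\<dots> \<le> real (card {g \<in> ?\<Gamma>. norm g \<le> real (n + 1) * \<rho>})"
    using le unfolding cD by (rule of_nat_mono)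
  finally show ?thesis unfolding \<rho>_def .
qed

text \<open>Compare the two counts at a radius beyond the last minimum: the power of the radius cancels.\<close>

lemma reduced_integer_vectors:
  fixes x :: "real ^ 'n"
  assumes T: "T > 0"
  defines "n \<equiv> CARD('n)"
  defines "\<mu> \<equiv> \<lambda>v. norm (scaled_shear x T v)"
  shows "\<exists>v. (\<forall>j<n+1. v j \<in> integer_vectors \<and> v j \<notin> span (v ` {..<j}) \<and> (\<forall>i\<le>j. \<mu> (v i) \<le> \<mu> (v j)))
     \<and> (\<Prod>j<n+1. \<mu> (v j)) \<le> (4 * real (n + 1) * real (n + 1)) ^ (n + 1)"
proof -
  let ?G = "scaled_shear x T"
  let ?\<Gamma> = "?G ` integer_vectors"
  let ?m = "n + 1"
  have dim: "DIM((real ^ 'n) \<times> real) = ?m" by (simp add: n_def)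
  have diff: "g - h \<in> ?\<Gamma>" if gh: "g \<in> ?\<Gamma>" "h \<in> ?\<Gamma>" for g h
  proof -
    obtain u v where uv: "u \<in> integer_vectors" "v \<in> integer_vectors" "g = ?G u" "h = ?G v"
      using gh by blast
    hence "g - h = ?G (u - v)" using linear_diff[OF linear_scaled_shear] by metis
    thus ?thesis using uv integer_vectors_closed(1) by blast
  qed
  have "span ?\<Gamma> = ?G ` UNIV"
    by (simp add: linear_span_image[OF linear_scaled_shear] span_integer_vectors)
  also have "\<dots> = UNIV"
    using linear_injective_imp_surjective[OF linear_scaled_shear inj_scaled_shear[OF T]] by simp
  finally obtain w where w: "successive_minima ?\<Gamma> w ?m"
    using successive_minima_exist[OF _ finite_scaled_shear_ball[OF T], of x ?m] dim by auto
  have "\<forall>j<?m. \<exists>u. u \<in> integer_vectors \<and> w j = ?G u" 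
    using w unfolding successive_minima_def by blast
  then obtain v where v: "\<And>j. j < ?m \<Longrightarrow> v j \<in> integer_vectors" "\<And>j. j < ?m \<Longrightarrow> w j = ?G (v j)"
    by metis
  have ind: "v j \<notin> span (v ` {..<j})" if "j < ?m" for j
  proof
    assume "v j \<in> span (v ` {..<j})"
    hence "?G (v j) \<in> span (?G ` v ` {..<j})"
      using linear_span_image[OF linear_scaled_shear, of x T "v ` {..<j}"] by blast
    moreover have "?G ` v ` {..<j} = w ` {..<j}" using v(2) that by (force simp: image_iff)
    moreover have "w j \<notin> span (w ` {..<j})" using w that by (auto simp: successive_minima_def)
    ultimately show False using v(2)[OF that] by simp
  qed
  have lam: "\<mu> (v j) = norm (w j)" if "j < ?m" for j using v(2)[OF that] by (simp add: \<mu>_def)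
  have mono: "\<mu> (v i) \<le> \<mu> (v j)" if "i \<le> j" "j < ?m" for i j
    using successive_minima_mono[OF w that] lam that by simp
  have "\<exists>M::nat. norm (w n) / (real ?m * T) \<le> real M" by (rule real_arch_simple)
  then obtain M0 :: nat where M0: "norm (w n) / (real ?m * T) \<le> real M0" ..
  define M where "M = Suc M0"
  define \<rho> where "\<rho> = real M * T"
  have "norm (w n) \<le> real M0 * (real ?m * T)" using M0 T by (simp add: divide_le_eq)
  also have "\<dots> \<le> real M * (real ?m * T)" using T by (intro mult_right_mono) (auto simp: M_def)
  finally have R: "norm (w (DIM((real ^ 'n) \<times> real) - 1)) \<le> real ?m * \<rho>"
    unfolding dim by (simp add: \<rho>_def mult_ac)
  have \<rho>: "\<rho> > 0" using T by (simp add: \<rho>_def M_def)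
  have "\<rho> ^ ?m * (\<Prod>j<?m. norm (w j)) \<le> real (card {g \<in> ?\<Gamma>. norm g \<le> real ?m * \<rho>}) * (\<Prod>j<?m. norm (w j))"
    using many_lattice_points[OF T, of M x]
    by (intro mult_right_mono prod_nonneg) (auto simp: M_def \<rho>_def n_def)
  also have "\<dots> \<le> (4 * real ?m * (real ?m * \<rho>)) ^ ?m"
    using minkowski_counting[OF diff, of w "real ?m * \<rho>"] w R unfolding dim by blast
  finally have le: "\<rho> ^ ?m * (\<Prod>j<?m. norm (w j)) \<le> (4 * real ?m * (real ?m * \<rho>)) ^ ?m" .
  have "4 * real ?m * (real ?m * \<rho>) = \<rho> * (4 * real ?m * real ?m)" by (rule mult.assoc[symmetric, THEN trans]) (rule mult.commute)
  from le[unfolded this power_mult_distrib[of \<rho>]] have "(\<Prod>j<?m. norm (w j)) \<le> (4 * real ?m * real ?m) ^ ?m"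
    by (rule mult_left_le_imp_le) (rule zero_less_power[OF \<rho>])
  moreover have "(\<Prod>j<?m. \<mu> (v j)) = (\<Prod>j<?m. norm (w j))" by (rule prod.cong) (auto simp: lam)
  ultimately show ?thesis using v(1) ind mono by (intro exI[of _ v] conjI allI impI) simp_all
qed

section \<open>Elimination with a pivot\<close>

lemma dual_family_exists:
  fixes v :: "'i \<Rightarrow> 'a::euclidean_space"
  assumes J: "finite J" and inj: "inj_on v J" and ind: "independent (v ` J)"
  shows "\<exists>f. dual_family (span (v ` J)) J v f"
proof -
  have "\<exists>g. linear g \<and> (\<forall>l\<in>J. g (v l) = (if j = l then 1 else (0::real)))" for j
  proof -
    obtain g where g: "linear g" "\<forall>u\<in>v ` J. g u = (if j = inv_into J v u then 1 else (0::real))"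
      using linear_independent_extend[OF ind, of "\<lambda>u. if j = inv_into J v u then 1 else 0"] by blast
    have "g (v l) = (if j = l then 1 else 0)" if "l \<in> J" for l
      using g(2) that inj by simp
    with g(1) show ?thesis by blast
  qed
  then obtain f where f: "\<And>j. linear (f j)" "\<And>j l. l \<in> J \<Longrightarrow> f j (v l) = (if j = l then 1 else (0::real))"
    by metis
  have rep: "(\<Sum>j\<in>J. f j u *\<^sub>R v j) = u" if "u \<in> span (v ` J)" for u
    using that
  proof (induction rule: span_induct_alt)
    case base
    then show ?case using f(1) by (simp add: linear_0)
  next
    case (step c x y)
    then obtain l where l: "l \<in> J" "x = v l" by auto
    have "(\<Sum>j\<in>J. f j x *\<^sub>R v j) = (\<Sum>j\<in>J. if j = l then v j else 0)"
      unfolding l(2) by (intro sum.cong) (auto simp: f(2)[OF l(1)])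
    also have "\<dots> = x" using l J by simp
    finally have x: "(\<Sum>j\<in>J. f j x *\<^sub>R v j) = x" .
    have "f j (c *\<^sub>R x + y) = c * f j x + f j y" for j
      using f(1)[of j] by (simp add: linear_add linear_scale)
    hence "(\<Sum>j\<in>J. f j (c *\<^sub>R x + y) *\<^sub>R v j) = c *\<^sub>R (\<Sum>j\<in>J. f j x *\<^sub>R v j) + (\<Sum>j\<in>J. f j y *\<^sub>R v j)"
      by (simp add: scaleR_left_distrib sum.distrib scaleR_sum_right)
    then show ?case using x step.IH by simp
  qed
  have "card J = dim (span (v ` J))"
    using ind inj by (simp add: dim_eq_card_independent card_image)
  moreover have "v ` J \<subseteq> span (v ` J)" by (rule span_superset)
  ultimately have "dual_family (span (v ` J)) J v f"
    unfolding dual_family_def using f rep J by simp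
  thus ?thesis by blast
qed

text \<open>Subtracting multiples of one basis vector from the others changes only the coordinate with respect to that vector.\<close>

lemma dual_family_shear:
  fixes V :: "'a::euclidean_space set"
  assumes D: "dual_family V J v f" and i: "i \<in> J"
  shows "dual_family V J (\<lambda>j. if j = i then v i else v j - c j *\<^sub>R v i)
    (\<lambda>j u. if j = i then f i u + (\<Sum>l\<in>J - {i}. c l * f l u) else f j u)"
proof -
  have V: "subspace V" and fin: "finite J" and k: "card J = dim V" and vV: "\<And>j. j \<in> J \<Longrightarrow> v j \<in> V"
    and lin: "\<And>j. j \<in> J \<Longrightarrow> linear (f j)"
    and d: "\<And>j l. j \<in> J \<Longrightarrow> l \<in> J \<Longrightarrow> f j (v l) = (if j = l then 1 else 0)"
    and rep: "\<And>u. u \<in> V \<Longrightarrow> (\<Sum>j\<in>J. f j u *\<^sub>R v j) = u"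
    using D by (auto simp: dual_family_def)
  define b where "b j = (if j = i then v i else v j - c j *\<^sub>R v i)" for j
  define g where "g j u = (if j = i then f i u + (\<Sum>l\<in>J - {i}. c l * f l u) else f j u)" for j u
  have bV: "b j \<in> V" if "j \<in> J" for j
    using vV i that V by (auto simp: b_def intro!: subspace_diff subspace_scale)
  have glin: "linear (g j)" if "j \<in> J" for j
  proof (rule linearI)
    fix a u w
    have fl: "f l (u + w) = f l u + f l w" "f l (a *\<^sub>R u) = a * f l u" if "l \<in> J" for l
      using lin[OF that] by (simp_all add: linear_add linear_scale)
    have "(\<Sum>l\<in>J - {i}. c l * f l (u + w)) = (\<Sum>l\<in>J - {i}. c l * f l u) + (\<Sum>l\<in>J - {i}. c l * f l w)"
      by (simp add: fl sum.distrib distrib_left)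
    thus "g j (u + w) = g j u + g j w" using fl that i by (simp add: g_def)
    have "(\<Sum>l\<in>J - {i}. c l * f l (a *\<^sub>R u)) = a * (\<Sum>l\<in>J - {i}. c l * f l u)"
      by (simp add: fl sum_distrib_left mult_ac)
    thus "g j (a *\<^sub>R u) = a *\<^sub>R g j u" using fl that i by (simp add: g_def distrib_left)
  qed
  have fb: "f l (b j) = (if j = i then (if l = i then 1 else 0) else (if l = j then 1 else 0) - c j * (if l = i then 1 else 0))"
    if "l \<in> J" "j \<in> J" for l j
    using that i d lin[OF that(1)] by (simp add: b_def linear_diff linear_scale)
  have gb: "g l (b j) = (if l = j then 1 else 0)" if lj: "l \<in> J" "j \<in> J" for l j
  proof (cases "l = i")
    case False
    then show ?thesis using fb[OF lj] by (simp add: g_def)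
  next
    case True
    have "(\<Sum>l\<in>J - {i}. c l * f l (b j)) = (\<Sum>l\<in>J - {i}. if l = j then c l else 0)"
      using lj by (intro sum.cong) (auto simp: fb)
    also have "\<dots> = (if j = i then 0 else c j)" using fin lj by simp
    finally show ?thesis using True fb[OF i lj(2)] by (auto simp: g_def)
  qed
  have "(\<Sum>j\<in>J. g j u *\<^sub>R b j) = u" if "u \<in> V" for u
  proof -
    have "(\<Sum>j\<in>J. g j u *\<^sub>R b j) = g i u *\<^sub>R v i + (\<Sum>j\<in>J - {i}. g j u *\<^sub>R b j)"
      using fin i by (simp add: sum.remove b_def)
    also have "(\<Sum>j\<in>J - {i}. g j u *\<^sub>R b j) = (\<Sum>j\<in>J - {i}. f j u *\<^sub>R v j - (c j * f j u) *\<^sub>R v i)"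
      by (intro sum.cong) (auto simp: g_def b_def scaleR_diff_right mult.commute)
    also have "\<dots> = (\<Sum>j\<in>J - {i}. f j u *\<^sub>R v j) - (\<Sum>l\<in>J - {i}. c l * f l u) *\<^sub>R v i"
      by (simp add: sum_subtractf scaleR_sum_left)
    also have "g i u *\<^sub>R v i + ((\<Sum>j\<in>J - {i}. f j u *\<^sub>R v j) - (\<Sum>l\<in>J - {i}. c l * f l u) *\<^sub>R v i)
        = f i u *\<^sub>R v i + (\<Sum>j\<in>J - {i}. f j u *\<^sub>R v j)"
      by (simp add: g_def scaleR_left_distrib)
    also have "\<dots> = u" using rep[OF that] fin i by (simp add: sum.remove)
    finally show ?thesis .
  qed
  hence "dual_family V J b g"
    using V fin k bV glin gb by (auto simp: dual_family_def)
  thus ?thesis by (simp add: b_def[abs_def] g_def[abs_def])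
qed

text \<open>The sheared vectors need not be integral, but their parallelepiped still meets every class modulo the lattice
  spanned by the \<open>v j\<close>: first move the coordinates other than \<open>i\<close> into the unit interval by integer multiples of
  the \<open>v j\<close>, which affects the \<open>i\<close>-th coordinate, and then correct that one by a multiple of \<open>v i\<close>.\<close>

lemma sheared_cell_covers:
  fixes V :: "((real ^ 'n) \<times> real) set" and c :: "'i \<Rightarrow> real"
  assumes D: "dual_family V J v f" and i: "i \<in> J"
    and int: "\<And>j. j \<in> J \<Longrightarrow> v j \<in> integer_vectors" and u: "u \<in> V"
  defines "g \<equiv> (\<lambda>j u. if j = i then f i u + (\<Sum>l\<in>J - {i}. c l * f l u) else f j u)"
  shows "\<exists>l\<in>V \<inter> integer_vectors. u - l \<in> cell V J g (\<lambda>_. 0)"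
proof -
  have V: "subspace V" and vV: "\<And>j. j \<in> J \<Longrightarrow> v j \<in> V" and lin: "\<And>j. j \<in> J \<Longrightarrow> linear (f j)"
    using D by (auto simp: dual_family_def)
  define s where "s = (\<Sum>l\<in>J - {i}. c l * of_int \<lfloor>f l u\<rfloor>)"
  define z where "z j = (if j = i then \<lfloor>g i u - s\<rfloor> else \<lfloor>f j u\<rfloor>)" for j
  define l where "l = (\<Sum>j\<in>J. of_int (z j) *\<^sub>R v j)"
  have lV: "l \<in> V" unfolding l_def using V vV by (intro subspace_sum subspace_scale) auto
  have lZ: "l \<in> integer_vectors"
    unfolding l_def using int by (intro sum_integer_vectors integer_vectors_closed(4)) auto
  have fl: "f j (u - l) = f j u - of_int (z j)" if "j \<in> J" for j
    using lin[OF that] dual_family_coord[OF D that] by (simp add: linear_diff l_def)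
  have "(\<Sum>l'\<in>J - {i}. c l' * f l' (u - l)) = (\<Sum>l'\<in>J - {i}. c l' * f l' u - c l' * of_int \<lfloor>f l' u\<rfloor>)"
    by (intro sum.cong) (auto simp: fl z_def right_diff_distrib)
  also have "\<dots> = (\<Sum>l'\<in>J - {i}. c l' * f l' u) - s" by (simp add: sum_subtractf s_def)
  finally have "g i (u - l) = g i u - s - of_int (z i)" using fl[OF i] by (simp add: g_def)
  hence "\<lfloor>g i (u - l)\<rfloor> = 0" by (simp add: z_def)
  moreover have "\<lfloor>g j (u - l)\<rfloor> = 0" if "j \<in> J" "j \<noteq> i" for j
    using fl[OF that(1)] that by (simp add: g_def z_def)
  ultimately have "u - l \<in> cell V J g (\<lambda>_. 0)"
    using V u lV by (auto simp: cell_def subspace_diff)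
  thus ?thesis using lV lZ by blast
qed

section \<open>Rational subspaces close to a point\<close>

text \<open>Put \<open>t j = snd (v j)\<close>, \<open>y j = fst (v j)\<close> and choose the pivot \<open>i\<close> to maximise \<open>\<bar>t i\<bar> / \<mu> i\<close>. Eliminating the last
  coordinate of \<open>v j\<close> with \<open>v i\<close> then costs at most a factor \<open>2\<close>: the result \<open>b j\<close> has norm at most \<open>2 \<mu> j / T\<close>,
  while \<open>v i\<close> has norm of order \<open>\<bar>t i\<bar>\<close>. The point \<open>y i / t i\<close> of \<open>L\<close> has distance at most \<open>\<mu> i / (T \<bar>t i\<bar>)\<close> from \<open>x\<close>,
  so that \<open>\<bar>t i\<bar>\<close> cancels in the product of distance and height. The hypothesis \<open>T > C\<close> forces \<open>t 0 \<noteq> 0\<close>: a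
  nonzero integer vector with last coordinate \<open>0\<close> has image of norm at least \<open>T\<close>, but \<open>\<mu> 0 \<le> C\<close>.\<close>

lemma rational_subspace_from_reduced_vectors:
  fixes x :: "real ^ 'n"
  assumes d: "d < CARD('n)" and T: "T > C" and C: "C \<ge> 1"
    and int: "\<And>j. j < CARD('n) + 1 \<Longrightarrow> v j \<in> integer_vectors"
    and ind: "\<And>j. j < CARD('n) + 1 \<Longrightarrow> v j \<notin> span (v ` {..<j})"
    and mono: "\<And>i j. i \<le> j \<Longrightarrow> j < CARD('n) + 1 \<Longrightarrow> norm (scaled_shear x T (v i)) \<le> norm (scaled_shear x T (v j))"
    and prod: "(\<Prod>j<CARD('n) + 1. norm (scaled_shear x T (v j))) \<le> C"
  shows "\<exists>L. affine L \<and> aff_dim L = int d \<and> rational_affine L \<and> 0 < height L \<and>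
     height L \<le> (8 * (real d + 1)) ^ (d + 1) * (2 + norm x) * C * T ^ (CARD('n) - d) \<and>
     dist_sup x L * height L \<le> (8 * (real d + 1)) ^ (d + 1) * (2 + norm x) * C / T ^ (d + 1)"
proof -
  define n where "n = CARD('n)"
  define k where "k = d + 1"
  have k: "k \<le> n" "k < n + 1" "0 < k" using d by (auto simp: k_def n_def)
  have T0: "T > 0" "T \<ge> 1" using T C by auto
  define \<mu> where "\<mu> j = norm (scaled_shear x T (v j))" for j
  define t where "t j = snd (v j)" for j
  define y where "y j = fst (v j)" for j
  have mono': "\<mu> i \<le> \<mu> j" if "i \<le> j" "j < n + 1" for i j using mono that by (simp add: \<mu>_def n_def)
  have prod': "(\<Prod>j<n + 1. \<mu> j) \<le> C" using prod by (simp add: \<mu>_def n_def)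
  have inj: "inj_on v {..<k}" and indep: "independent (v ` {..<k})"
    using flag_inj_independent[of k v] ind k by (auto simp: n_def)
  have pos: "\<mu> j > 0" if "j < n + 1" for j
  proof -
    have "v j \<noteq> 0" using ind[of j] that span_zero[of "v ` {..<j}"] by (auto simp: n_def)
    hence "scaled_shear x T (v j) \<noteq> 0"
      using inj_scaled_shear[OF T0(1), of x] linear_0[OF linear_scaled_shear, of x T] by (metis injD)
    thus ?thesis by (simp add: \<mu>_def)
  qed
  \<comment> \<open>Either all factors are at most \<open>1\<close>, or all factors left out are at least \<open>1\<close>.\<close>
  have prefix: "(\<Prod>j<l. \<mu> j) \<le> C" if l: "l < n + 1" for l
  proof (cases "\<mu> l \<le> 1")
    case True
    have "(\<Prod>j<l. \<mu> j) \<le> (\<Prod>j<l. 1)"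
    proof (rule prod_mono, intro conjI)
      fix j assume "j \<in> {..<l}"
      thus "0 \<le> \<mu> j" "\<mu> j \<le> 1" using mono'[of j l] True l by (auto simp: \<mu>_def)
    qed
    thus ?thesis using C by simp
  next
    case False
    have "{..<n + 1} = {..<l} \<union> {l..<n + 1}" using l by auto
    hence "(\<Prod>j<n + 1. \<mu> j) = prod \<mu> ({..<l} \<union> {l..<n + 1})" by (rule arg_cong)
    also have "\<dots> = (\<Prod>j<l. \<mu> j) * (\<Prod>j=l..<n + 1. \<mu> j)"
      by (rule prod.union_disjoint) auto
    finally have "(\<Prod>j<n + 1. \<mu> j) = (\<Prod>j<l. \<mu> j) * (\<Prod>j=l..<n + 1. \<mu> j)" .
    moreover have "1 \<le> (\<Prod>j=l..<n + 1. \<mu> j)"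
    proof (rule prod_ge_1)
      fix j assume "j \<in> {l..<n + 1}"
      thus "1 \<le> \<mu> j" using mono'[of l j] False by simp
    qed
    moreover have "0 \<le> (\<Prod>j<l. \<mu> j)" by (intro prod_nonneg) (auto simp: \<mu>_def)
    ultimately show ?thesis using prod' mult_left_mono[of 1 "\<Prod>j=l..<n + 1. \<mu> j" "\<Prod>j<l. \<mu> j"] by simp
  qed
  have \<mu>0: "\<mu> 0 \<le> C" using prefix[of 1] k by simp
  have sh1: "norm (y j - t j *\<^sub>R x) \<le> \<mu> j / T" for j
  proof -
    have "T * norm (y j - t j *\<^sub>R x) \<le> \<mu> j"
      using norm_fst_le[of "fst (scaled_shear x T (v j))" "snd (scaled_shear x T (v j))"] T0
      by (simp add: scaled_shear_def \<mu>_def y_def t_def)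
    thus ?thesis using T0 by (simp add: le_divide_eq mult.commute)
  qed
  have sh2: "\<bar>t j\<bar> \<le> T ^ n * \<mu> j" for j
  proof -
    have "\<bar>t j\<bar> / T ^ n \<le> \<mu> j"
      using norm_snd_le[of "snd (scaled_shear x T (v j))" "fst (scaled_shear x T (v j))"] T0
      by (simp add: scaled_shear_def \<mu>_def t_def n_def)
    thus ?thesis using T0 by (simp add: divide_le_eq mult.commute)
  qed
  have t0: "1 \<le> \<bar>t 0\<bar>"
  proof -
    have vi: "v 0 \<in> integer_vectors" using int[of 0] by simp
    have "t 0 \<noteq> 0"
    proof
      assume z: "t 0 = 0"
      have "y 0 \<noteq> 0"
      proof
        assume "y 0 = 0"
        hence "v 0 = 0" using z by (simp add: y_def t_def prod_eq_iff)
        thus False using ind[of 0] span_zero[of "{}"] by simp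
      qed
      then obtain i where i: "y 0 $ i \<noteq> 0" by (auto simp: vec_eq_iff)
      have "y 0 $ i \<in> \<int>" using vi by (auto simp: integer_vectors_def y_def)
      hence "1 \<le> \<bar>y 0 $ i\<bar>" using i by (rule Ints_nonzero_abs_ge1)
      also have "\<dots> \<le> norm (y 0)" by (rule component_le_norm_cart)
      also have "\<dots> \<le> \<mu> 0 / T" using sh1[of 0] z by simp
      finally have "T \<le> \<mu> 0" using T0 by (simp add: le_divide_eq)
      thus False using \<mu>0 T by simp
    qed
    moreover have "t 0 \<in> \<int>" using vi by (auto simp: integer_vectors_def t_def)
    ultimately show ?thesis using Ints_nonzero_abs_ge1 by blast
  qed
  obtain i where i: "i < k" and imax: "\<And>j. j < k \<Longrightarrow> \<bar>t j\<bar> / \<mu> j \<le> \<bar>t i\<bar> / \<mu> i"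
  proof -
    define S where "S = (\<lambda>j. \<bar>t j\<bar> / \<mu> j) ` {..<k}"
    have S: "finite S" "S \<noteq> {}" using k by (auto simp: S_def)
    then obtain i where "i < k" "Max S = \<bar>t i\<bar> / \<mu> i" 
      using Max_in[OF S] unfolding S_def by (elim imageE) blast
    moreover have "\<bar>t j\<bar> / \<mu> j \<le> Max S" if "j < k" for j
      using S that by (intro Max_ge) (auto simp: S_def)
    ultimately show ?thesis using that by metis
  qed
  have piv: "\<bar>t j\<bar> * \<mu> i \<le> \<bar>t i\<bar> * \<mu> j" if "j < k" for j
    using imax[OF that] pos[of j] pos[of i] that i k by (simp add: field_simps)
  have "\<mu> i * 1 \<le> \<mu> i * \<bar>t 0\<bar>" using t0 pos[of i] i k by (intro mult_left_mono) auto
  also have "\<dots> \<le> \<bar>t i\<bar> * \<mu> 0" using piv[of 0] k by (simp add: mult.commute)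
  also have "\<dots> \<le> \<bar>t i\<bar> * T" using \<mu>0 T by (intro mult_left_mono) auto
  \<comment> \<open>The vector \<open>v i\<close> is dominated by its last coordinate.\<close>
  finally have ti: "\<mu> i / T \<le> \<bar>t i\<bar>" using T0 by (simp add: divide_le_eq)
  have "\<mu> i / T > 0" using pos[of i] i k T0 by simp
  hence ti0: "\<bar>t i\<bar> > 0" using ti by linarith
  define V where "V = span (v ` {..<k})"
  obtain f where D: "dual_family V {..<k} v f"
    using dual_family_exists[OF _ inj indep] by (auto simp: V_def)
  have V: "subspace V" and dimV: "dim V = k"
    using D by (auto simp: dual_family_def)
  define c where "c j = t j / t i" for j
  define b where "b = (\<lambda>j. if j = i then v i else v j - c j *\<^sub>R v i)"
  define g where "g = (\<lambda>j u. if j = i then f i u + (\<Sum>l\<in>{..<k} - {i}. c l * f l u) else f j u)"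
  have ik: "i \<in> {..<k}" using i by simp
  have D': "dual_family V {..<k} b g"
    unfolding b_def g_def by (rule dual_family_shear[OF D ik])
  have vint: "v j \<in> integer_vectors" if "j \<in> {..<k}" for j using int[of j] that k by (simp add: n_def)
  have bj: "norm (b j) \<le> 2 * \<mu> j / T" if j: "j < k" "j \<noteq> i" for j
  proof -
    have "snd (b j) = 0" using ti0 j by (simp add: b_def c_def t_def[symmetric])
    hence "norm (b j) = norm (fst (b j))" by (simp add: norm_prod_def)
    also have "fst (b j) = (y j - t j *\<^sub>R x) - c j *\<^sub>R (y i - t i *\<^sub>R x)"
      using ti0 j by (simp add: b_def c_def y_def algebra_simps)
    also have "norm \<dots> \<le> norm (y j - t j *\<^sub>R x) + \<bar>c j\<bar> * norm (y i - t i *\<^sub>R x)"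
      using norm_triangle_ineq4[of "y j - t j *\<^sub>R x" "c j *\<^sub>R (y i - t i *\<^sub>R x)"] by simp
    also have "\<dots> \<le> \<mu> j / T + \<bar>c j\<bar> * (\<mu> i / T)"
      by (intro add_mono mult_left_mono sh1) auto
    also have "\<bar>c j\<bar> * (\<mu> i / T) \<le> \<mu> j / T"
    proof -
      have "\<bar>c j\<bar> * \<mu> i \<le> \<mu> j" using piv[OF j(1)] ti0 by (simp add: c_def divide_le_eq mult.commute)
      thus ?thesis using T0 by (simp add: divide_right_mono)
    qed
    finally show ?thesis by simp
  qed
  have bi: "norm (b i) \<le> \<bar>t i\<bar> * (2 + norm x)"
  proof -
    have "norm (v i) \<le> norm (y i) + \<bar>t i\<bar>"
      using norm_Pair_le[of "y i" "t i"] by (simp add: y_def t_def)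
    also have "norm (y i) \<le> norm (y i - t i *\<^sub>R x) + norm (t i *\<^sub>R x)"
      using norm_triangle_sub[of "y i" "t i *\<^sub>R x"] by simp
    also have "norm (y i - t i *\<^sub>R x) \<le> \<bar>t i\<bar>" using sh1[of i] ti by simp
    finally show ?thesis by (simp add: b_def algebra_simps)
  qed
  define P where "P = (\<Prod>j<k. \<mu> j)"
  have P: "0 \<le> P" "P \<le> C" using prefix k by (auto simp: P_def \<mu>_def intro: prod_nonneg)
  define A where "A = (8 * real k) ^ k * (2 + norm x)"
  have A0: "A \<ge> 0" by (simp add: A_def)
  \<comment> \<open>The last factor, at least \<open>1\<close> and at most \<open>T ^ (n + 1)\<close>, is the inverse of the bound for the distance.\<close>
  have vol: "(4 * real k) ^ k * (\<Prod>j<k. norm (b j)) \<le> A * P / T ^ k * (T * \<bar>t i\<bar> / \<mu> i)"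
  proof -
    have "(\<Prod>j<k. norm (b j)) = norm (b i) * (\<Prod>j\<in>{..<k} - {i}. norm (b j))"
      using ik by (simp add: prod.remove)
    also have "\<dots> \<le> (\<bar>t i\<bar> * (2 + norm x)) * (\<Prod>j\<in>{..<k} - {i}. 2 * \<mu> j / T)"
      using bi bj by (intro mult_mono prod_mono prod_nonneg) auto
    also have "(\<Prod>j\<in>{..<k} - {i}. 2 * \<mu> j / T) = (\<Prod>j<k. 2 * \<mu> j / T) / (2 * \<mu> i / T)"
      using ik pos[of i] i k T0 by (simp add: prod.remove)
    also have "(\<Prod>j<k. 2 * \<mu> j / T) = 2 ^ k * P / T ^ k"
      by (simp add: P_def prod_dividef prod.distrib)
    also have "(\<bar>t i\<bar> * (2 + norm x)) * (2 ^ k * P / T ^ k / (2 * \<mu> i / T))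
       = 2 ^ k * (2 + norm x) * P / T ^ k * (T * \<bar>t i\<bar> / \<mu> i) / 2"
      using pos[of i] i k T0 by (simp add: field_simps)
    also have "\<dots> \<le> 2 ^ k * (2 + norm x) * P / T ^ k * (T * \<bar>t i\<bar> / \<mu> i)"
    proof -
      have "0 \<le> 2 ^ k * (2 + norm x) * P / T ^ k * (T * \<bar>t i\<bar> / \<mu> i)"
        using P T0 pos[of i] i k by (intro mult_nonneg_nonneg divide_nonneg_nonneg) auto
      moreover have "a / 2 \<le> a" if "0 \<le> a" for a :: real using that by simp
      ultimately show ?thesis by blast
    qed
    finally have "(4 * real k) ^ k * (\<Prod>j<k. norm (b j))
       \<le> (4 * real k) ^ k * (2 ^ k * (2 + norm x) * P / T ^ k * (T * \<bar>t i\<bar> / \<mu> i))"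
      by (rule mult_left_mono) simp
    also have "\<dots> = ((4 * real k) ^ k * 2 ^ k) * (2 + norm x) * P / T ^ k * (T * \<bar>t i\<bar> / \<mu> i)"
      by simp
    also have "(4 * real k) ^ k * 2 ^ k = (8 * real k) ^ k"
      unfolding power_mult_distrib[symmetric] by simp
    finally show ?thesis by (simp add: A_def)
  qed
  define L where "L = {y. (y, 1) \<in> V}"
  have vi: "v i \<in> V" "snd (v i) \<noteq> 0"
    using ik ti0 by (auto simp: V_def t_def intro: span_base)
  have dV: "dim V = d + 1" using dimV by (simp add: k_def)
  note L = dehomogenize[OF V vi dV, folded L_def]
  have vsub: "v ` {..<k} \<subseteq> integer_vectors" using vint by blast
  have rat: "rational_affine L"
    unfolding rational_affine_def L(3) using vsub indep by (intro exI[of _ "v ` {..<k}"]) (auto simp: V_def)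
  have cellV: "cell V {..<k} g (\<lambda>_. 0) \<subseteq> V" by (auto simp: cell_def)
  have vol0: "0 \<le> (4 * real k) ^ k * (\<Prod>j<k. norm (b j))" by (intro mult_nonneg_nonneg prod_nonneg) auto
  have cov: "\<exists>l\<in>V \<inter> integer_vectors. u - l \<in> cell V {..<k} g (\<lambda>_. 0)" if "u \<in> V" for u
    unfolding g_def by (rule sheared_cell_covers[OF D ik vint that])
  have "emeasure (subspace_lborel V) (cell V {..<k} g (\<lambda>_. 0)) \<le> ennreal ((4 * real k) ^ k * (\<Prod>j<k. norm (b j)))"
    using parallelepiped_volume_le[OF D'] by (simp add: dimV)
  note ht = covolume_le_covering[OF V cell_borel[OF D'] cellV cov this vol0]
  have H0: "0 < height L" using ht(1) by (simp add: height_def L(3))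
  have H1: "height L \<le> A * P / T ^ k * (T * \<bar>t i\<bar> / \<mu> i)"
    using ht(2) vol by (simp add: height_def L(3))
  have APC: "A * P / T ^ k \<le> A * C / T ^ k"
    using P A0 T0 by (intro divide_right_mono mult_left_mono) auto
  have AP0: "0 \<le> A * P / T ^ k" using P A0 T0 by simp
  have W: "T * \<bar>t i\<bar> / \<mu> i \<le> T * T ^ n"
  proof -
    have "T * \<bar>t i\<bar> \<le> T * (T ^ n * \<mu> i)" using sh2[of i] T0 by (intro mult_left_mono) auto
    thus ?thesis using pos[of i] i k by (simp add: divide_le_eq mult.assoc)
  qed
  have "0 \<le> A * C / T ^ k" using AP0 APC by simp
  moreover have "0 \<le> T * \<bar>t i\<bar> / \<mu> i" using T0 pos[of i] i k by simp
  ultimately have "A * P / T ^ k * (T * \<bar>t i\<bar> / \<mu> i) \<le> A * C / T ^ k * (T * T ^ n)"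
    by (intro mult_mono APC W)
  with H1 have "height L \<le> A * C / T ^ k * (T * T ^ n)" by (rule order.trans)
  also have "\<dots> = A * C * T ^ (n - d)"
  proof -
    have "T * T ^ n = T ^ (n - d) * T ^ k" using d by (simp add: power_add[symmetric] k_def n_def flip: power_Suc)
    thus ?thesis using T0 by simp
  qed
  finally have H2: "height L \<le> A * C * T ^ (n - d)" .
  have "dist_sup x L \<le> infnorm (x - (1 / snd (v i)) *\<^sub>R fst (v i))"
    unfolding dist_sup_def
  proof (rule cINF_lower)
    show "bdd_below ((\<lambda>y. infnorm (x - y)) ` L)"
      by (rule bdd_belowI2[of _ 0]) (rule infnorm_pos_le)
  qed (rule L(4))
  also have "\<dots> \<le> norm (x - (1 / snd (v i)) *\<^sub>R fst (v i))" by (rule infnorm_le_norm)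
  also have "\<dots> = norm (y i - t i *\<^sub>R x) / \<bar>t i\<bar>"
  proof -
    have "x - (1 / snd (v i)) *\<^sub>R fst (v i) = (- 1 / t i) *\<^sub>R (y i - t i *\<^sub>R x)"
      using ti0 by (simp add: y_def t_def algebra_simps)
    thus ?thesis by simp
  qed
  also have "\<dots> \<le> \<mu> i / T / \<bar>t i\<bar>" using sh1[of i] by (intro divide_right_mono) auto
  finally have ds: "dist_sup x L \<le> \<mu> i / T / \<bar>t i\<bar>" .
  have "dist_sup x L * height L \<le> (\<mu> i / T / \<bar>t i\<bar>) * (A * P / T ^ k * (T * \<bar>t i\<bar> / \<mu> i))"
    using ds H1 H0 pos[of i] i k T0 by (intro mult_mono) auto
  also have "\<dots> = A * P / T ^ k" using ti0 pos[of i] i k T0 by simp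
  also have "\<dots> \<le> A * C / T ^ k" by (rule APC)
  finally have H3: "dist_sup x L * height L \<le> A * C / T ^ k" .
  have Ak: "(8 * (real d + 1)) ^ (d + 1) * (2 + norm x) = A" by (simp only: A_def k_def of_nat_add of_nat_1)
  show ?thesis
    unfolding Ak using L rat H0 H2 H3 by (intro exI[of _ L]) (auto simp: n_def k_def)
qed

text \<open>The span of \<open>d\<close> coordinate directions and the last one has an orthonormal basis of integer vectors, whose unit cell
  covers it modulo the lattice.\<close>

lemma coordinate_subspace_height:
  fixes D :: "'n::finite set"
  assumes d: "card D = d"
  shows "\<exists>L :: (real ^ 'n) set. L \<noteq> {} \<and> affine L \<and> aff_dim L = int d \<and> rational_affine L \<and> 0 < height L \<and> height L \<le> 1"
proof -
  define E0 :: "((real ^ 'n) \<times> real) set" where "E0 = insert (0, 1) ((\<lambda>i. (axis i 1, 0)) ` D)"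
  define V where "V = span E0"
  have V: "subspace V" by (simp add: V_def)
  have int: "e \<in> integer_vectors" if "e \<in> E0" for e
    using that by (auto simp: E0_def integer_vectors_def axis_def)
  have norm1: "norm e = 1" if "e \<in> E0" for e
    using that by (auto simp: E0_def norm_prod_def)
  have orth: "pairwise orthogonal E0"
    by (auto simp: pairwise_def E0_def orthogonal_def inner_axis_axis)
  have on: "orthonormal_basis V E0"
    using orth norm1 by (simp add: orthonormal_basis_def V_def)
  have bij: "bij_betw (\<lambda>e. e) E0 E0" by (simp add: bij_betw_def)
  note F = orthonormal_dual_family(1)[OF on bij]
  have "card E0 = d + 1"
  proof -
    have "inj_on (\<lambda>i. (axis i 1 :: real ^ 'n, 0 :: real)) D"
      by (auto simp: inj_on_def axis_eq_axis)
    moreover have "(0, 1) \<notin> (\<lambda>i. (axis i 1 :: real ^ 'n, 0 :: real)) ` D" by auto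
    moreover have "finite D" by simp
    ultimately show ?thesis using d by (simp add: E0_def card_image)
  qed
  hence dV: "dim V = d + 1" using orthonormal_basis_facts(3)[OF on] by simp
  have e: "(0, 1) \<in> V" "snd (0 :: real ^ 'n, 1 :: real) \<noteq> 0"
    by (auto simp: V_def E0_def intro: span_base)
  define L where "L = {y. (y, 1) \<in> V}"
  note L = dehomogenize[OF V e dV, folded L_def]
  have "0 \<notin> E0" using norm1[of 0] by auto
  hence "independent E0" using orth by (rule pairwise_orthogonal_independent[rotated])
  hence rat: "rational_affine L"
    unfolding rational_affine_def L(3) using int by (intro exI[of _ E0]) (auto simp: V_def)
  have iE: "(0, 1) \<in> E0" by (simp add: E0_def)
  have cover: "\<exists>l\<in>V \<inter> integer_vectors. u - l \<in> cell V E0 (\<lambda>e v. v \<bullet> e) (\<lambda>_. 0)" if "u \<in> V" for u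
    using sheared_cell_covers[OF F iE int that, where c = "\<lambda>_. 0"] by (auto simp: cell_def split: if_splits)
  have "emeasure (subspace_lborel V) (cell V E0 (\<lambda>e v. v \<bullet> e) (\<lambda>_. 0)) \<le> ennreal 1"
    using orthonormal_cell_volume_le_1[OF V on] by simp
  note ht = covolume_le_covering[OF V cell_borel[OF F] _ cover this]
  have "cell V E0 (\<lambda>e v. v \<bullet> e) (\<lambda>_. 0) \<subseteq> V" by (auto simp: cell_def)
  from ht[OF this] have "0 < height L" "height L \<le> 1" by (simp_all add: height_def L(3))
  moreover have "L \<noteq> {}" using L(4) by blast
  ultimately show ?thesis using L rat by blast
qed

text \<open>
  With \<open>T = (N / B) powr (1 / (n - d))\<close> the height bound becomes \<open>N\<close> and \<open>B / T ^ (d + 1)\<close> becomes a multiple of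
  \<open>N powr (- \<omega>)\<close>. If this \<open>T\<close> is too small, then \<open>N \<le> N0\<close> and the second summand of \<open>c\<close> absorbs the distance from
  \<open>x\<close> to a fixed coordinate subspace.
\<close>

theorem theorem1p3:
  fixes x :: "real ^ 'n" and d :: nat
  assumes "d < CARD('n)"
  shows "\<exists>c>0. \<forall>N::nat. N \<ge> 1 \<longrightarrow>
           (\<exists>L :: (real ^ 'n) set.
              affine L \<and> aff_dim L = int d \<and> rational_affine L \<and>
              dist_sup x L \<le> c * inverse (height L) * real N powr (- omega CARD('n) d) \<and>
              height L \<le> real N)"
proof -
  define n where "n = CARD('n)"
  have dn: "d < n" using assms by (simp add: n_def)
  define C where "C = (4 * real (n + 1) * real (n + 1)) ^ (n + 1)"
  have "1 * 1 \<le> (4 * real (n + 1)) * real (n + 1)" by (intro mult_mono) auto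
  hence C: "C \<ge> 1" unfolding C_def by (intro one_le_power) simp
  define B where "B = (8 * (real d + 1)) ^ (d + 1) * (2 + norm x) * C"
  have "1 * 1 * 1 \<le> B"
    unfolding B_def using C by (intro mult_mono one_le_power) auto
  hence B: "B \<ge> 1" by simp
  have large: "\<exists>L. affine L \<and> aff_dim L = int d \<and> rational_affine L \<and> 0 < height L \<and>
     height L \<le> B * T ^ (n - d) \<and> dist_sup x L * height L \<le> B / T ^ (d + 1)" if T: "T > C" for T
  proof -
    have "T > 0" using T C by simp
    from reduced_integer_vectors[OF this, of x] obtain v where v:
      "\<And>j. j < n + 1 \<Longrightarrow> v j \<in> integer_vectors" "\<And>j. j < n + 1 \<Longrightarrow> v j \<notin> span (v ` {..<j})"
      "\<And>i j. i \<le> j \<Longrightarrow> j < n + 1 \<Longrightarrow> norm (scaled_shear x T (v i)) \<le> norm (scaled_shear x T (v j))"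
      "(\<Prod>j<n + 1. norm (scaled_shear x T (v j))) \<le> C"
      unfolding n_def C_def by blast
    show ?thesis
      using rational_subspace_from_reduced_vectors[OF assms T C v[unfolded n_def]] unfolding B_def n_def .
  qed
  obtain D :: "'n set" where D: "card D = d"
    using obtain_subset_with_card_n[of d "UNIV :: 'n set"] assms by auto
  obtain L0 :: "(real ^ 'n) set" where L0: "L0 \<noteq> {}" "affine L0" "aff_dim L0 = int d" "rational_affine L0"
      "0 < height L0" "height L0 \<le> 1"
    using coordinate_subspace_height[OF D] by blast
  define \<omega> where "\<omega> = omega n d"
  have \<omega>: "\<omega> = (real d + 1) / real (n - d)" using dn by (simp add: \<omega>_def omega_def of_nat_diff)
  have \<omega>0: "\<omega> \<ge> 0" by (simp add: \<omega>)
  define r where "r = dist_sup x L0"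
  have r0: "r \<ge> 0" unfolding r_def dist_sup_def using L0(1) by (intro cINF_greatest infnorm_pos_le)
  define N0 where "N0 = B * C ^ (n - d)"
  have N0: "N0 > 0" using B C by (simp add: N0_def)
  define c where "c = B * B powr \<omega> + r * N0 powr \<omega>"
  have c: "c > 0" using B r0 N0 by (auto simp: c_def intro!: add_pos_nonneg)
  show ?thesis
  proof (intro exI[of _ c] conjI allI impI c)
    fix N :: nat assume N: "N \<ge> 1"
    define T where "T = (real N / B) powr (1 / real (n - d))"
    have NB: "real N / B > 0" using N B by simp
    have T0: "T > 0" using N B by (simp add: T_def)
    have Tp: "T ^ (n - d) = real N / B"
      using T0 NB B dn by (simp add: T_def powr_realpow[symmetric] powr_powr)
    have Tk: "T ^ (d + 1) = (real N / B) powr \<omega>"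
      using T0 by (simp add: T_def powr_realpow[symmetric] powr_powr \<omega> add.commute del: power_Suc)
    show "\<exists>L :: (real ^ 'n) set.
              affine L \<and> aff_dim L = int d \<and> rational_affine L \<and>
              dist_sup x L \<le> c * inverse (height L) * real N powr (- omega CARD('n) d) \<and>
              height L \<le> real N"
    proof (cases "T > C")
      case True
      then obtain L where L: "affine L" "aff_dim L = int d" "rational_affine L" "0 < height L"
        "height L \<le> B * T ^ (n - d)" "dist_sup x L * height L \<le> B / T ^ (d + 1)"
        using large by blast
      have "B / T ^ (d + 1) = B * B powr \<omega> * real N powr (- \<omega>)"
        unfolding Tk using N B by (simp add: powr_divide powr_minus field_simps)
      also have "\<dots> \<le> c * real N powr (- \<omega>)"
        using r0 by (intro mult_right_mono) (auto simp: c_def)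
      finally have "dist_sup x L * height L \<le> c * real N powr (- \<omega>)" using L(6) by simp
      hence "dist_sup x L \<le> c * real N powr (- \<omega>) / height L" using L(4) by (simp add: le_divide_eq)
      hence "dist_sup x L \<le> c * inverse (height L) * real N powr (- \<omega>)"
        by (simp add: divide_inverse mult_ac)
      moreover have "height L \<le> real N" using L(5) B by (simp add: Tp)
      ultimately show ?thesis using L by (auto simp: \<omega>_def n_def)
    next
      case False
      hence "T ^ (n - d) \<le> C ^ (n - d)" using T0 by (intro power_mono) auto
      hence "real N \<le> N0" using B by (simp add: Tp N0_def divide_le_eq mult.commute)
      hence "real N powr \<omega> \<le> N0 powr \<omega>" using \<omega>0 by (intro powr_mono2) auto
      hence "r * real N powr \<omega> \<le> c * 1"
        using r0 B mult_left_mono[of "real N powr \<omega>" "N0 powr \<omega>" r] by (simp add: c_def add_increasing)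
      also have "\<dots> \<le> c * inverse (height L0)"
        using c L0 by (intro mult_left_mono) (auto simp: one_le_inverse_iff)
      finally have "r \<le> c * inverse (height L0) / real N powr \<omega>"
        using N by (simp add: le_divide_eq)
      hence "r \<le> c * inverse (height L0) * real N powr (- \<omega>)"
        by (simp add: powr_minus divide_inverse)
      moreover have "height L0 \<le> real N" using L0(6) N by simp
      ultimately show ?thesis using L0 by (auto simp: \<omega>_def n_def r_def)
    qed
  qed
qed

end
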